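(* Let $\Gamma$ be a countable group with identity element $e$, and let $H$ be a Hilbert space. Assume that there is a map $f:\Gamma\to H$ and a constant $M\geq 0$ such that $$\|f(sx)-f(sy)\|^2\leq \|f(x)-f(y)\|^2 + M,\quad\forall s,x,y\in\Gamma.$$ Then there exist a measure space $(\Omega,\mu)$, a closed subspace $E\subset L^1(\Omega,\mu)$, and a uniformly bounded representation $\pi:\Gamma\to\mathcal{B}(E)$ such that $\pi$ admits a cocycle $b:\Gamma\to E$ satisfying $$\|b(s)\|_E=\|f(s)-f(e)\|_H +2,\quad\forall s\in\Gamma\setminus\{e\}.$$
   Context: $L^1(\Omega,\mu)$ is the Banach space of (classes of) real-valued integrable functions, and $E$ carries the norm induced from $L^1(\Omega,\mu)$, denoted $\|\cdot\|_E$. $\mathcal{B}(E)$ denotes the algebra of bounded linear operators on $E$. A representation $\pi:\Gamma\to\mathcal{B}(E)$ is a map with $\pi(e)=\mathrm{id}_E$ and $\pi(st)=\pi(s)\pi(t)$ for all $s,t\in\Gamma$; it is uniformly bounded if $\sup_{s\in\Gamma}\|\pi(s)\|<\infty$. A cocycle for $\pi$ is a map $b:\Gamma\to E$ satisfying $b(st)=\pi(s)b(t)+b(s)$ for all $s,t\in\Gamma$. *)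

theory Defs
  imports "HOL-Analysis.Analysis" "HOL-Algebra.Group"
begin

section \<open>The Banach space of classes of real integrable functions\<close>

definition L1_rel :: "'w measure \<Rightarrow> (('w \<Rightarrow> real) \<times> ('w \<Rightarrow> real)) set" where
  "L1_rel \<mu> = {(f, g). integrable \<mu> f \<and> integrable \<mu> g \<and> (AE x in \<mu>. f x = g x)}"

definition L1_space :: "'w measure \<Rightarrow> ('w \<Rightarrow> real) set set" where
  "L1_space \<mu> = {f. integrable \<mu> f} // L1_rel \<mu>"

definition L1_class :: "'w measure \<Rightarrow> ('w \<Rightarrow> real) \<Rightarrow> ('w \<Rightarrow> real) set" where
  "L1_class \<mu> f = L1_rel \<mu> `` {f}"

text \<open>The operations are defined through a chosen representative; independence of the choice
  is shown below.\<close>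

definition L1_rep :: "('w \<Rightarrow> real) set \<Rightarrow> 'w \<Rightarrow> real" where
  "L1_rep X = (SOME f. f \<in> X)"

definition L1_zero :: "'w measure \<Rightarrow> ('w \<Rightarrow> real) set" where
  "L1_zero \<mu> = L1_class \<mu> (\<lambda>_. 0)"

definition L1_add :: "'w measure \<Rightarrow> ('w \<Rightarrow> real) set \<Rightarrow> ('w \<Rightarrow> real) set \<Rightarrow> ('w \<Rightarrow> real) set" where
  "L1_add \<mu> X Y = L1_class \<mu> (\<lambda>x. L1_rep X x + L1_rep Y x)"

definition L1_scale :: "'w measure \<Rightarrow> real \<Rightarrow> ('w \<Rightarrow> real) set \<Rightarrow> ('w \<Rightarrow> real) set" where
  "L1_scale \<mu> c X = L1_class \<mu> (\<lambda>x. c * L1_rep X x)"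

definition L1_norm :: "'w measure \<Rightarrow> ('w \<Rightarrow> real) set \<Rightarrow> real" where
  "L1_norm \<mu> X = (LINT x|\<mu>. \<bar>L1_rep X x\<bar>)"

definition L1_dist :: "'w measure \<Rightarrow> ('w \<Rightarrow> real) set \<Rightarrow> ('w \<Rightarrow> real) set \<Rightarrow> real" where
  "L1_dist \<mu> X Y = (LINT x|\<mu>. \<bar>L1_rep X x - L1_rep Y x\<bar>)"

lemma equiv_L1_rel: "equiv {f. integrable \<mu> f} (L1_rel \<mu>)"
proof (rule equivI)
  show "refl_on {f. integrable \<mu> f} (L1_rel \<mu>)"
    by (auto simp: L1_rel_def refl_on_def)
  show "sym (L1_rel \<mu>)"
    by (auto simp: L1_rel_def sym_def elim: AE_mp)
  show "trans (L1_rel \<mu>)"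
    by (auto simp: L1_rel_def trans_def elim: AE_mp)
qed (auto simp: L1_rel_def)

lemma L1_space_eq: "L1_space \<mu> = L1_class \<mu> ` {f. integrable \<mu> f}"
  by (auto simp: L1_space_def L1_class_def quotient_def)

lemma L1_class_in_space: "integrable \<mu> f \<Longrightarrow> L1_class \<mu> f \<in> L1_space \<mu>"
  by (auto simp: L1_space_eq)

lemma L1_class_eq_iff:
  assumes "integrable \<mu> f" "integrable \<mu> g"
  shows "L1_class \<mu> f = L1_class \<mu> g \<longleftrightarrow> (AE x in \<mu>. f x = g x)"
  unfolding L1_class_def
  using eq_equiv_class_iff[OF equiv_L1_rel, of f \<mu> g] assms by (simp add: L1_rel_def)

lemma L1_rep_class:
  assumes "integrable \<mu> f"
  shows "integrable \<mu> (L1_rep (L1_class \<mu> f))"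
    and "AE x in \<mu>. L1_rep (L1_class \<mu> f) x = f x"
proof -
  have "f \<in> L1_class \<mu> f"
    using assms by (simp add: L1_class_def L1_rel_def)
  then have "L1_rep (L1_class \<mu> f) \<in> L1_class \<mu> f"
    unfolding L1_rep_def by (rule someI[of "\<lambda>g. g \<in> L1_class \<mu> f"])
  then show "integrable \<mu> (L1_rep (L1_class \<mu> f))"
    and "AE x in \<mu>. L1_rep (L1_class \<mu> f) x = f x"
    by (auto simp: L1_class_def L1_rel_def elim: AE_mp)
qed

lemma L1_rep_integrable: "X \<in> L1_space \<mu> \<Longrightarrow> integrable \<mu> (L1_rep X)"
  by (auto simp: L1_space_eq L1_rep_class)

lemma L1_class_rep:
  assumes "X \<in> L1_space \<mu>"
  shows "L1_class \<mu> (L1_rep X) = X"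
proof -
  obtain f where f: "integrable \<mu> f" "X = L1_class \<mu> f"
    using assms by (auto simp: L1_space_eq)
  then show ?thesis
    using L1_class_eq_iff L1_rep_class by blast
qed

lemma L1_add_class:
  assumes f: "integrable \<mu> f" and g: "integrable \<mu> g"
  shows "L1_add \<mu> (L1_class \<mu> f) (L1_class \<mu> g) = L1_class \<mu> (\<lambda>x. f x + g x)"
proof -
  have "AE x in \<mu>. L1_rep (L1_class \<mu> f) x + L1_rep (L1_class \<mu> g) x = f x + g x"
    using L1_rep_class(2)[OF f] L1_rep_class(2)[OF g] by eventually_elim simp
  then show ?thesis
    unfolding L1_add_def using L1_rep_class(1) f g by (subst L1_class_eq_iff) auto
qed

lemma L1_scale_class:
  assumes f: "integrable \<mu> f"
  shows "L1_scale \<mu> c (L1_class \<mu> f) = L1_class \<mu> (\<lambda>x. c * f x)"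
proof -
  have "AE x in \<mu>. c * L1_rep (L1_class \<mu> f) x = c * f x"
    using L1_rep_class(2)[OF f] by eventually_elim simp
  then show ?thesis
    unfolding L1_scale_def using L1_rep_class(1) f by (subst L1_class_eq_iff) auto
qed

lemma L1_norm_class:
  assumes f: "integrable \<mu> f"
  shows "L1_norm \<mu> (L1_class \<mu> f) = (LINT x|\<mu>. \<bar>f x\<bar>)"
  unfolding L1_norm_def
proof (rule integral_cong_AE)
  show "AE x in \<mu>. \<bar>L1_rep (L1_class \<mu> f) x\<bar> = \<bar>f x\<bar>"
    using L1_rep_class(2)[OF f] by eventually_elim simp
qed (use L1_rep_class(1)[OF f] f in auto)

lemma L1_dist_norm:
  assumes X: "X \<in> L1_space \<mu>" and Y: "Y \<in> L1_space \<mu>"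
  shows "L1_dist \<mu> X Y = L1_norm \<mu> (L1_add \<mu> X (L1_scale \<mu> (-1) Y))"
proof -
  note i = L1_rep_integrable[OF X] L1_rep_integrable[OF Y]
  have "L1_add \<mu> X (L1_scale \<mu> (-1) Y)
      = L1_add \<mu> (L1_class \<mu> (L1_rep X)) (L1_class \<mu> (\<lambda>x. - 1 * L1_rep Y x))"
    by (simp add: L1_class_rep[OF X] L1_scale_def)
  also have "\<dots> = L1_class \<mu> (\<lambda>x. L1_rep X x - L1_rep Y x)"
    using i by (subst L1_add_class) auto
  finally show ?thesis
    using i by (simp add: L1_norm_class L1_dist_def)
qed

lemma Metric_space_L1: "Metric_space (L1_space \<mu>) (L1_dist \<mu>)"
proof
  show "0 \<le> L1_dist \<mu> X Y" for X Y
    by (simp add: L1_dist_def)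
  show "L1_dist \<mu> X Y = L1_dist \<mu> Y X" for X Y
    by (simp add: L1_dist_def abs_minus_commute)
  show "L1_dist \<mu> X Y = 0 \<longleftrightarrow> X = Y" if X: "X \<in> L1_space \<mu>" and Y: "Y \<in> L1_space \<mu>" for X Y
  proof -
    note i = L1_rep_integrable[OF X] L1_rep_integrable[OF Y]
    have "L1_dist \<mu> X Y = 0 \<longleftrightarrow> (AE x in \<mu>. \<bar>L1_rep X x - L1_rep Y x\<bar> = 0)"
      unfolding L1_dist_def using i by (intro integral_nonneg_eq_0_iff_AE) auto
    also have "\<dots> \<longleftrightarrow> L1_class \<mu> (L1_rep X) = L1_class \<mu> (L1_rep Y)"
      by (simp add: L1_class_eq_iff[OF i])
    finally show ?thesis
      by (simp add: L1_class_rep X Y)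
  qed
  show "L1_dist \<mu> X Z \<le> L1_dist \<mu> X Y + L1_dist \<mu> Y Z"
    if X: "X \<in> L1_space \<mu>" and Y: "Y \<in> L1_space \<mu>" and Z: "Z \<in> L1_space \<mu>" for X Y Z
  proof -
    note i = L1_rep_integrable[OF X] L1_rep_integrable[OF Y] L1_rep_integrable[OF Z]
    have "L1_dist \<mu> X Z
        \<le> (LINT x|\<mu>. \<bar>L1_rep X x - L1_rep Y x\<bar> + \<bar>L1_rep Y x - L1_rep Z x\<bar>)"
      unfolding L1_dist_def using i by (intro integral_mono) auto
    also have "\<dots> = L1_dist \<mu> X Y + L1_dist \<mu> Y Z"
      unfolding L1_dist_def using i by (intro Bochner_Integration.integral_add) auto
    finally show ?thesis .
  qed
qed

section \<open>Closed subspaces, bounded operators, representations and cocycles\<close>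

definition L1_closed_subspace :: "'w measure \<Rightarrow> ('w \<Rightarrow> real) set set \<Rightarrow> bool" where
  "L1_closed_subspace \<mu> E \<longleftrightarrow>
     E \<subseteq> L1_space \<mu> \<and>
     L1_zero \<mu> \<in> E \<and>
     (\<forall>X\<in>E. \<forall>Y\<in>E. L1_add \<mu> X Y \<in> E) \<and>
     (\<forall>c. \<forall>X\<in>E. L1_scale \<mu> c X \<in> E) \<and>
     closedin (Metric_space.mtopology (L1_space \<mu>) (L1_dist \<mu>)) E"

text \<open>An operator on \<open>E\<close> is a function on all classes of which only the restriction
  to \<open>E\<close> matters.\<close>

definition L1_bounded_operator ::
  "'w measure \<Rightarrow> ('w \<Rightarrow> real) set set \<Rightarrow> (('w \<Rightarrow> real) set \<Rightarrow> ('w \<Rightarrow> real) set) \<Rightarrow> bool" where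
  "L1_bounded_operator \<mu> E T \<longleftrightarrow>
     (\<forall>X\<in>E. T X \<in> E) \<and>
     (\<forall>X\<in>E. \<forall>Y\<in>E. T (L1_add \<mu> X Y) = L1_add \<mu> (T X) (T Y)) \<and>
     (\<forall>c. \<forall>X\<in>E. T (L1_scale \<mu> c X) = L1_scale \<mu> c (T X)) \<and>
     (\<exists>K. \<forall>X\<in>E. L1_norm \<mu> (T X) \<le> K * L1_norm \<mu> X)"

definition L1_operator_norm ::
  "'w measure \<Rightarrow> ('w \<Rightarrow> real) set set \<Rightarrow> (('w \<Rightarrow> real) set \<Rightarrow> ('w \<Rightarrow> real) set) \<Rightarrow> real" where
  "L1_operator_norm \<mu> E T = (SUP X\<in>{X\<in>E. L1_norm \<mu> X \<le> 1}. L1_norm \<mu> (T X))"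

definition L1_representation ::
  "('g, 'm) monoid_scheme \<Rightarrow> 'w measure \<Rightarrow> ('w \<Rightarrow> real) set set \<Rightarrow>
   ('g \<Rightarrow> ('w \<Rightarrow> real) set \<Rightarrow> ('w \<Rightarrow> real) set) \<Rightarrow> bool" where
  "L1_representation G \<mu> E \<pi> \<longleftrightarrow>
     (\<forall>s\<in>carrier G. L1_bounded_operator \<mu> E (\<pi> s)) \<and>
     (\<forall>X\<in>E. \<pi> \<one>\<^bsub>G\<^esub> X = X) \<and>
     (\<forall>s\<in>carrier G. \<forall>t\<in>carrier G. \<forall>X\<in>E. \<pi> (s \<otimes>\<^bsub>G\<^esub> t) X = \<pi> s (\<pi> t X))"

definition L1_uniformly_bounded ::
  "('g, 'm) monoid_scheme \<Rightarrow> 'w measure \<Rightarrow> ('w \<Rightarrow> real) set set \<Rightarrow>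
   ('g \<Rightarrow> ('w \<Rightarrow> real) set \<Rightarrow> ('w \<Rightarrow> real) set) \<Rightarrow> bool" where
  "L1_uniformly_bounded G \<mu> E \<pi> \<longleftrightarrow>
     bdd_above ((\<lambda>s. L1_operator_norm \<mu> E (\<pi> s)) ` carrier G)"

definition L1_cocycle ::
  "('g, 'm) monoid_scheme \<Rightarrow> 'w measure \<Rightarrow> ('w \<Rightarrow> real) set set \<Rightarrow>
   ('g \<Rightarrow> ('w \<Rightarrow> real) set \<Rightarrow> ('w \<Rightarrow> real) set) \<Rightarrow> ('g \<Rightarrow> ('w \<Rightarrow> real) set) \<Rightarrow> bool" where
  "L1_cocycle G \<mu> E \<pi> b \<longleftrightarrow>
     (\<forall>s\<in>carrier G. b s \<in> E) \<and>
     (\<forall>s\<in>carrier G. \<forall>t\<in>carrier G. b (s \<otimes>\<^bsub>G\<^esub> t) = L1_add \<mu> (\<pi> s (b t)) (b s))"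

end

theory Submission
  imports Defs "HOL-Probability.Probability"
begin

text \<open>
  For a finitely supported function \<open>a\<close> on the group with \<open>\<Sum>t. a t = 0\<close> put
  \<open>N a = norm (\<Sum>t. a t *\<^sub>R f t) + (\<Sum>t. \<bar>a t\<bar>)\<close>. The whole construction is the completion of the space
  of such functions under \<open>N\<close>, with the group acting by left translation and with the cocycle
  \<open>b s = \<delta>\<^sub>s - \<delta>\<^sub>e\<close>, for which \<open>N (b s) = norm (f s - f e) + 2\<close> if \<open>s \<noteq> e\<close>.

  Translation is bounded for \<open>N\<close>. Since \<open>a\<close> sums to zero,
  \<open>2 * norm (\<Sum>t. a t *\<^sub>R f t)^2 = - (\<Sum>t u. a t * a u * norm (f t - f u)^2)\<close>. The hypothesis, used for
  \<open>s\<close> and for its inverse, says that replacing \<open>f t\<close> by \<open>f (s t)\<close> changes each squared distance by at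
  most \<open>M\<close>, hence the double sum by at most \<open>M * (\<Sum>t. \<bar>a t\<bar>)^2\<close>. So the Hilbert space norm grows by at
  most \<open>sqrt (M / 2) * (\<Sum>t. \<bar>a t\<bar>)\<close>, which the second summand of \<open>N\<close> absorbs: every translation has
  norm at most \<open>1 + sqrt (M / 2)\<close> (\<open>norm_lin_comb_perturbed\<close>, \<open>vec_shift_norm_le\<close>).

  The norm \<open>N\<close> is an \<open>L\<^sup>1\<close> norm. A linear combination of independent standard Gaussian variables has a
  first absolute moment proportional to the Euclidean norm of its coefficients, so after
  orthonormalising the countable family \<open>f\<close> the first summand of \<open>N\<close> becomes the \<open>L\<^sup>1\<close> norm of a Gaussian
  variable. The second summand is the \<open>\<ell>\<^sup>1\<close> norm, which lives on a disjoint part of the measure space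
  (\<open>L1_realisation\<close>).

  For an infinite group these functions do not form a complete space, so the subspace is the closure
  of its image in \<open>L\<^sup>1\<close>. By completeness of \<open>L\<^sup>1\<close> the translations extend to the closure with the same
  bound, and the laws of a representation pass to the limit (\<open>L1_representation_extension\<close>).
\<close>

section \<open>Orthonormalising a sequence of vectors\<close>

text \<open>
  As \<open>sgn 0 = 0\<close>, a vector that depends linearly on its predecessors yields \<open>0\<close>, so the family is
  orthonormal up to zeros for every sequence \<open>v\<close>.
\<close>

fun gram_schmidt :: "(nat \<Rightarrow> 'a::real_inner) \<Rightarrow> nat \<Rightarrow> 'a" where
  "gram_schmidt v n = sgn (v n - (\<Sum>i<n. (v n \<bullet> gram_schmidt v i) *\<^sub>R gram_schmidt v i))"

declare gram_schmidt.simps [simp del]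

lemma gram_schmidt_unit: "gram_schmidt v n = 0 \<or> gram_schmidt v n \<bullet> gram_schmidt v n = 1"
proof -
  have "norm (gram_schmidt v n) = 0 \<or> norm (gram_schmidt v n) = 1"
    by (subst (1 2) gram_schmidt.simps) (simp add: norm_sgn)
  then show ?thesis
    by (auto simp: dot_square_norm)
qed

lemma gram_schmidt_orthogonal_less:
  "i < n \<Longrightarrow> gram_schmidt v n \<bullet> gram_schmidt v i = 0"
proof (induction n arbitrary: i rule: less_induct)
  case (less n)
  define e where "e = gram_schmidt v"
  have orth: "e j \<bullet> e i = 0" if "j < n" "j \<noteq> i" for j
    using less.IH[of i j] less.IH[of j i] less.prems that
    by (cases "j < i") (auto simp: e_def inner_commute not_less)
  have "(\<Sum>j<n. (v n \<bullet> e j) *\<^sub>R e j) \<bullet> e i = (\<Sum>j<n. if j = i then (v n \<bullet> e i) * (e i \<bullet> e i) else 0)"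
    unfolding inner_sum_left by (rule sum.cong) (auto simp: orth)
  also have "\<dots> = v n \<bullet> e i"
    using less.prems gram_schmidt_unit[of v i] by (auto simp: e_def)
  finally show ?case
    by (subst gram_schmidt.simps) (simp add: sgn_div_norm e_def inner_diff_left)
qed

lemma gram_schmidt_orthogonal:
  "i \<noteq> j \<Longrightarrow> gram_schmidt v i \<bullet> gram_schmidt v j = 0"
  by (metis gram_schmidt_orthogonal_less inner_commute linorder_neqE_nat)

lemma gram_schmidt_expand_atMost:
  "v n = (\<Sum>i\<le>n. (v n \<bullet> gram_schmidt v i) *\<^sub>R gram_schmidt v i)"
proof -
  define e where "e = gram_schmidt v"
  define w where "w = v n - (\<Sum>i<n. (v n \<bullet> e i) *\<^sub>R e i)"
  have en: "e n = sgn w"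
    unfolding w_def e_def by (subst gram_schmidt.simps) simp
  have "v n \<bullet> e n = w \<bullet> e n"
    by (simp add: w_def inner_diff_left inner_sum_left e_def gram_schmidt_orthogonal)
  also have "\<dots> = norm w"
    by (cases "w = 0") (simp_all add: en sgn_div_norm dot_square_norm power2_eq_square)
  finally have "(v n \<bullet> e n) *\<^sub>R e n = w"
    by (cases "w = 0") (simp_all add: en sgn_div_norm)
  then show ?thesis
    by (simp add: w_def e_def[symmetric] lessThan_Suc_atMost[symmetric])
qed

text \<open>
  Triangularity is what keeps the Gaussian variables below elementary: each vector of the sequence
  has finitely many coordinates, so no infinite series of Gaussian variables occurs.
\<close>

lemma gram_schmidt_triangular:
  assumes "k < i"
  shows "v k \<bullet> gram_schmidt v i = 0"
  using assms by (subst gram_schmidt_expand_atMost) (simp add: inner_sum_left gram_schmidt_orthogonal)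

lemma gram_schmidt_expand:
  assumes "k < m"
  shows "v k = (\<Sum>i<m. (v k \<bullet> gram_schmidt v i) *\<^sub>R gram_schmidt v i)"
proof -
  have "(\<Sum>i<m. (v k \<bullet> gram_schmidt v i) *\<^sub>R gram_schmidt v i)
      = (\<Sum>i\<le>k. (v k \<bullet> gram_schmidt v i) *\<^sub>R gram_schmidt v i)"
    using assms by (intro sum.mono_neutral_right) (auto simp: gram_schmidt_triangular)
  then show ?thesis
    using gram_schmidt_expand_atMost[of v k] by simp
qed

text \<open>
  Parseval's identity, which survives the vectors normalised to \<open>0\<close> because these contribute \<open>0\<close> both to
  the expansion and to the sum of squares.
\<close>

lemma norm_sum_gram_schmidt:
  assumes "F \<subseteq> {..<m}"
  shows "(norm (\<Sum>k\<in>F. a k *\<^sub>R v k))\<^sup>2 = (\<Sum>i<m. (\<Sum>k\<in>F. a k * (v k \<bullet> gram_schmidt v i))\<^sup>2)"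
proof -
  define e where "e = gram_schmidt v"
  define u where "u = (\<Sum>k\<in>F. a k *\<^sub>R v k)"
  have ui: "u \<bullet> e i = (\<Sum>k\<in>F. a k * (v k \<bullet> e i))" for i
    by (simp add: u_def inner_sum_left)
  have "u = (\<Sum>k\<in>F. a k *\<^sub>R (\<Sum>i<m. (v k \<bullet> e i) *\<^sub>R e i))"
    unfolding u_def using assms gram_schmidt_expand[of _ m v]
    by (intro sum.cong) (auto simp: e_def)
  also have "\<dots> = (\<Sum>i<m. (u \<bullet> e i) *\<^sub>R e i)"
    by (simp add: ui scaleR_sum_right scaleR_sum_left sum.swap[of _ "{..<m}"])
  finally have "u \<bullet> u = u \<bullet> (\<Sum>i<m. (u \<bullet> e i) *\<^sub>R e i)"
    by simp
  also have "\<dots> = (\<Sum>i<m. (u \<bullet> e i)\<^sup>2)"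
    by (simp add: inner_sum_right power2_eq_square)
  finally show ?thesis
    by (simp add: ui[unfolded e_def, symmetric] e_def u_def[symmetric] power2_norm_eq_inner)
qed

section \<open>Linear combinations of independent Gaussian variables\<close>

definition std_gaussian :: "(nat \<Rightarrow> real) measure" where
  "std_gaussian = (\<Pi>\<^sub>M i\<in>UNIV. density lborel std_normal_density)"

lemma sets_std_gaussian [measurable_cong]: "sets std_gaussian = sets (\<Pi>\<^sub>M i\<in>UNIV. borel)"
  unfolding std_gaussian_def by (rule sets_PiM_cong) auto

lemma prob_space_std_gaussian: "prob_space std_gaussian"
  unfolding std_gaussian_def by (intro prob_space_PiM prob_space_normal_density) simp

lemma distributed_std_gaussian_coordinate:
  "distributed std_gaussian lborel (\<lambda>x. x i) std_normal_density"
proof -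
  have "distr std_gaussian (density lborel std_normal_density) (\<lambda>x. x i) = density lborel std_normal_density"
    unfolding std_gaussian_def
    by (intro distr_PiM_component prob_space_normal_density) simp_all
  moreover have "distr std_gaussian (density lborel std_normal_density) (\<lambda>x. x i)
      = distr std_gaussian lborel (\<lambda>x. x i)"
    by (rule distr_cong) auto
  ultimately show ?thesis
    by (auto simp: distributed_def)
qed

lemma indep_std_gaussian_coordinates:
  "prob_space.indep_vars std_gaussian (\<lambda>_. borel) (\<lambda>i x. x i) UNIV"
proof -
  interpret prob_space std_gaussian by (rule prob_space_std_gaussian)
  have "distr std_gaussian (\<Pi>\<^sub>M i\<in>UNIV. borel) (\<lambda>x. \<lambda>i\<in>UNIV. x i) = distr std_gaussian std_gaussian (\<lambda>x. x)"
    by (rule distr_cong) (auto simp: sets_std_gaussian)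
  also have "\<dots> = std_gaussian"
    by simp
  also have "\<dots> = (\<Pi>\<^sub>M i\<in>UNIV. distr std_gaussian borel (\<lambda>x. x i))"
  proof -
    have "distr std_gaussian borel (\<lambda>x. x i) = density lborel std_normal_density" for i
      using distributed_std_gaussian_coordinate[of i]
      by (simp add: distributed_def cong: distr_cong)
    then show ?thesis
      by (simp add: std_gaussian_def)
  qed
  finally show ?thesis
    by (subst indep_vars_iff_distr_eq_PiM) auto
qed

text \<open>
  The sum is again a centred normal variable, its variance being the sum of the squares of the
  coefficients, and \<open>sqrt (2 / pi)\<close> is the first absolute moment of the standard normal distribution.
\<close>

lemma std_gaussian_abs_linear:
  fixes c :: "nat \<Rightarrow> real"
  shows "integrable std_gaussian (\<lambda>x. \<Sum>i<m. c i * x i)"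
    and "(LINT x|std_gaussian. \<bar>\<Sum>i<m. c i * x i\<bar>) = sqrt (2 / pi) * sqrt (\<Sum>i<m. (c i)\<^sup>2)"
proof -
  interpret prob_space std_gaussian by (rule prob_space_std_gaussian)
  \<comment> \<open>A normal density needs a positive variance, so vanishing coefficients are discarded first.\<close>
  define I where "I = {i\<in>{..<m}. c i \<noteq> 0}"
  have sum_I: "(\<Sum>i<m. c i * x i) = (\<Sum>i\<in>I. c i * x i)" for x :: "nat \<Rightarrow> real"
    by (rule sum.mono_neutral_right) (auto simp: I_def)
  have sum_I2: "(\<Sum>i<m. (c i)\<^sup>2) = (\<Sum>i\<in>I. (c i)\<^sup>2)"
    by (rule sum.mono_neutral_right) (auto simp: I_def)
  have "integrable std_gaussian (\<lambda>x. \<Sum>i<m. c i * x i) \<and>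
    (LINT x|std_gaussian. \<bar>\<Sum>i<m. c i * x i\<bar>) = sqrt (2 / pi) * sqrt (\<Sum>i<m. (c i)\<^sup>2)"
  proof (cases "I = {}")
    case True
    then show ?thesis by (simp add: sum_I sum_I2)
  next
    case False
    define \<sigma> where "\<sigma> = sqrt (\<Sum>i\<in>I. \<bar>c i\<bar>\<^sup>2)"
    have fin: "finite I" by (simp add: I_def)
    have pos: "\<sigma> > 0"
      unfolding \<sigma>_def using False fin by (auto intro!: sum_pos simp: I_def)
    have "indep_vars (\<lambda>_. borel) (\<lambda>i x. c i * x i) I"
      using indep_vars_compose2[OF indep_vars_subset[OF indep_std_gaussian_coordinates, of I],
          of "\<lambda>i y. c i * y" "\<lambda>_. borel"] by simp
    moreover have "distributed std_gaussian lborel (\<lambda>x. c i * x i) (normal_density 0 \<bar>c i\<bar>)"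
      if "i \<in> I" for i
      using normal_density_affine[OF distributed_std_gaussian_coordinate[of i], of "c i" 0] that
      by (simp add: I_def)
    ultimately have D: "distributed std_gaussian lborel (\<lambda>x. \<Sum>i\<in>I. c i * x i) (normal_density 0 \<sigma>)"
      using sum_indep_normal[of I "\<lambda>i x. c i * x i" "\<lambda>i. \<bar>c i\<bar>" "\<lambda>_. 0"] fin False
      by (simp add: \<sigma>_def I_def)
    have "integrable std_gaussian (\<lambda>x. \<Sum>i\<in>I. c i * x i)"
      using distributed_integrable_var[OF D] integrable_normal_moment[where \<mu>=0 and \<sigma>=\<sigma> and k=1] pos by simp
    moreover have "(LINT x|std_gaussian. \<bar>\<Sum>i\<in>I. c i * x i\<bar>) = sqrt (2 / pi) * \<sigma>"
      using distributed_integral[OF D, of abs] normal_moment_abs_odd[of \<sigma> 0 0] pos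
      by (simp add: has_bochner_integral_iff mult.commute)
    ultimately show ?thesis
      by (simp add: sum_I sum_I2 \<sigma>_def)
  qed
  then show "integrable std_gaussian (\<lambda>x. \<Sum>i<m. c i * x i)"
    and "(LINT x|std_gaussian. \<bar>\<Sum>i<m. c i * x i\<bar>) = sqrt (2 / pi) * sqrt (\<Sum>i<m. (c i)\<^sup>2)"
    by auto
qed

section \<open>A measure space for the sum of a Hilbert norm and a summable norm\<close>

text \<open>
  The disjoint union of countably many copies of the Gaussian space, one for each natural number. The
  copy is recorded in coordinate \<open>0\<close> of the sequence, and the Gaussian coordinates move up by one.
\<close>

definition tagged_gaussian :: "(nat \<Rightarrow> real) measure" where
  "tagged_gaussian = distr (count_space UNIV \<Otimes>\<^sub>M std_gaussian) (\<Pi>\<^sub>M i\<in>UNIV. borel)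
     (\<lambda>(n, x). case_nat (real n) x)"

lemma nn_integral_tagged_gaussian:
  assumes [measurable]: "h \<in> borel_measurable (\<Pi>\<^sub>M i\<in>UNIV. borel)"
  shows "(\<integral>\<^sup>+ y. h y \<partial>tagged_gaussian)
    = (\<integral>\<^sup>+ n. (\<integral>\<^sup>+ x. h (case_nat (real n) x) \<partial>std_gaussian) \<partial>count_space UNIV)"
proof -
  interpret prob_space std_gaussian by (rule prob_space_std_gaussian)
  have [measurable]: "(\<lambda>(n, x). case_nat (real n) x)
      \<in> (count_space UNIV \<Otimes>\<^sub>M std_gaussian) \<rightarrow>\<^sub>M (\<Pi>\<^sub>M i\<in>UNIV. borel)"
    by measurable
  have "(\<integral>\<^sup>+ y. h y \<partial>tagged_gaussian)
      = (\<integral>\<^sup>+ p. h (case p of (n, x) \<Rightarrow> case_nat (real n) x) \<partial>(count_space UNIV \<Otimes>\<^sub>M std_gaussian))"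
    unfolding tagged_gaussian_def by (intro nn_integral_distr) auto
  also have "\<dots> = (\<integral>\<^sup>+ n. (\<integral>\<^sup>+ x. h (case_nat (real n) x) \<partial>std_gaussian) \<partial>count_space UNIV)"
    by (subst nn_integral_fst[symmetric]) auto
  finally show ?thesis .
qed

text \<open>
  Copy \<open>0\<close> carries the Gaussian variable of \<open>v n\<close>, scaled so that its \<open>L\<^sup>1\<close> norm is \<open>norm (v n)\<close>. Each other
  copy is a probability space and serves as one atom of an \<open>\<ell>\<^sup>1\<close> space: copy \<open>n + 1\<close> is the atom of index
  \<open>n\<close>.
\<close>

definition tagged_vector :: "(nat \<Rightarrow> 'a::real_inner) \<Rightarrow> nat \<Rightarrow> (nat \<Rightarrow> real) \<Rightarrow> real" where
  "tagged_vector v n y =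
     (if y 0 = 0 then sqrt (pi / 2) * (\<Sum>i\<le>n. (v n \<bullet> gram_schmidt v i) * y (Suc i)) else 0)
     + of_bool (y 0 = real (Suc n))"

lemma tagged_vector_measurable [measurable]:
  "tagged_vector v n \<in> borel_measurable (\<Pi>\<^sub>M i\<in>UNIV. borel)"
  unfolding tagged_vector_def by measurable

lemma sets_tagged_gaussian [measurable_cong]: "sets tagged_gaussian = sets (\<Pi>\<^sub>M i\<in>UNIV. borel)"
  by (simp add: tagged_gaussian_def)

text \<open>
  The absolute value of a combination is integrated over one copy at a time: copy \<open>0\<close> yields the norm of
  the combination of the vectors, and copy \<open>k + 1\<close> yields \<open>\<bar>a k\<bar>\<close>, since only the variable of index \<open>k\<close> is
  nonzero there.
\<close>

lemma nn_integral_tagged_combination: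
  fixes v :: "nat \<Rightarrow> 'a::real_inner"
  assumes "finite F"
  shows "(\<integral>\<^sup>+ y. \<bar>\<Sum>n\<in>F. a n * tagged_vector v n y\<bar> \<partial>tagged_gaussian)
    = ennreal (norm (\<Sum>n\<in>F. a n *\<^sub>R v n) + (\<Sum>n\<in>F. \<bar>a n\<bar>))"
proof -
  define h where "h y = \<bar>\<Sum>n\<in>F. a n * tagged_vector v n y\<bar>" for y
  define e where "e = gram_schmidt v"
  define c where "c i = (\<Sum>k\<in>F. a k * (v k \<bullet> e i))" for i
  obtain m where m: "F \<subseteq> {..<m}"
    using assms finite_nat_bounded by blast
  have pos: "sqrt (pi / 2) * sqrt (2 / pi) = 1"
    by (simp add: real_sqrt_mult[symmetric])
  have h0: "h (case_nat (real 0) x) = sqrt (pi / 2) * \<bar>\<Sum>i<m. c i * x i\<bar>" for x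
  proof -
    have "(\<Sum>i\<le>n. (v n \<bullet> e i) * x i) = (\<Sum>i<m. (v n \<bullet> e i) * x i)" if "n \<in> F" for n
      using that m by (intro sum.mono_neutral_left) (auto simp: e_def gram_schmidt_triangular)
    then have "(\<Sum>n\<in>F. a n * tagged_vector v n (case_nat (real 0) x))
        = (\<Sum>n\<in>F. a n * (sqrt (pi / 2) * (\<Sum>i<m. (v n \<bullet> e i) * x i)))"
      by (intro sum.cong) (simp_all add: tagged_vector_def e_def)
    also have "\<dots> = sqrt (pi / 2) * (\<Sum>i<m. c i * x i)"
      by (simp add: c_def sum_distrib_left sum_distrib_right sum.swap[of _ "{..<m}"] mult_ac)
    finally show ?thesis
      by (simp add: h_def abs_mult)
  qed
  have h1: "h (case_nat (real (Suc k)) x) = (if k \<in> F then \<bar>a k\<bar> else 0)" for k x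
  proof -
    have "(\<Sum>n\<in>F. a n * tagged_vector v n (case_nat (real (Suc k)) x)) = (\<Sum>n\<in>F. if n = k then a k else 0)"
      by (intro sum.cong) (auto simp: tagged_vector_def)
    then show ?thesis
      using assms by (simp add: h_def)
  qed
  have "(\<integral>\<^sup>+ x. h (case_nat (real 0) x) \<partial>std_gaussian) = norm (\<Sum>n\<in>F. a n *\<^sub>R v n)"
  proof -
    have "(\<integral>\<^sup>+ x. h (case_nat (real 0) x) \<partial>std_gaussian)
        = ennreal (LINT x|std_gaussian. sqrt (pi / 2) * \<bar>\<Sum>i<m. c i * x i\<bar>)"
      unfolding h0 by (intro nn_integral_eq_integral integrable_mult_right integrable_abs std_gaussian_abs_linear(1)) auto
    also have "(LINT x|std_gaussian. sqrt (pi / 2) * \<bar>\<Sum>i<m. c i * x i\<bar>) = sqrt (\<Sum>i<m. (c i)\<^sup>2)"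
      using pos by (simp add: std_gaussian_abs_linear(2))
    also have "\<dots> = norm (\<Sum>n\<in>F. a n *\<^sub>R v n)"
      unfolding c_def e_def norm_sum_gram_schmidt[OF m, of a v, symmetric] by simp
    finally show ?thesis .
  qed
  note i0 = this
  interpret prob_space std_gaussian by (rule prob_space_std_gaussian)
  have i1: "(\<integral>\<^sup>+ x. h (case_nat (real (Suc k)) x) \<partial>std_gaussian) = ennreal (if k \<in> F then \<bar>a k\<bar> else 0)" for k
    unfolding h1 by (simp add: emeasure_space_1)
  have "(\<integral>\<^sup>+ y. h y \<partial>tagged_gaussian)
      = (\<integral>\<^sup>+ n. (\<integral>\<^sup>+ x. h (case_nat (real n) x) \<partial>std_gaussian) \<partial>count_space UNIV)"
    by (rule nn_integral_tagged_gaussian) (unfold h_def, measurable)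
  also have "\<dots> = (\<Sum>n\<in>insert 0 (Suc ` F). \<integral>\<^sup>+ x. h (case_nat (real n) x) \<partial>std_gaussian)"
  proof (rule nn_integral_count_space')
    fix n assume n: "n \<notin> insert 0 (Suc ` F)"
    then obtain k where "n = Suc k" by (cases n) auto
    with n i1[of k] show "(\<integral>\<^sup>+ x. h (case_nat (real n) x) \<partial>std_gaussian) = 0"
      by auto
  qed (use assms in auto)
  also have "\<dots> = norm (\<Sum>n\<in>F. a n *\<^sub>R v n) + (\<Sum>k\<in>F. ennreal \<bar>a k\<bar>)"
    using assms i0 i1 by (simp add: sum.reindex)
  also have "\<dots> = ennreal (norm (\<Sum>n\<in>F. a n *\<^sub>R v n) + (\<Sum>n\<in>F. \<bar>a n\<bar>))"
    by (simp add: sum_nonneg ennreal_plus)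
  finally show ?thesis
    by (simp add: h_def)
qed

lemma integrable_tagged_vector: "integrable tagged_gaussian (tagged_vector v n)"
proof (rule integrableI_bounded)
  show "(\<integral>\<^sup>+ y. ennreal (norm (tagged_vector v n y)) \<partial>tagged_gaussian) < \<infinity>"
    using nn_integral_tagged_combination[of "{n}" "\<lambda>_. 1" v] by simp
qed measurable

lemma integral_tagged_combination:
  fixes v :: "nat \<Rightarrow> 'a::real_inner"
  assumes "finite F"
  shows "(LINT y|tagged_gaussian. \<bar>\<Sum>n\<in>F. a n * tagged_vector v n y\<bar>)
    = norm (\<Sum>n\<in>F. a n *\<^sub>R v n) + (\<Sum>n\<in>F. \<bar>a n\<bar>)"
  using nn_integral_tagged_combination[OF assms, of a v]
  by (subst integral_eq_nn_integral)
    (auto simp: sum_nonneg simp del: ennreal_plus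
      intro!: borel_measurable_integrable[OF integrable_tagged_vector])

section \<open>Arithmetic and completeness of the space of integrable classes\<close>

lemma L1_dist_class:
  assumes f: "integrable \<mu> f" and g: "integrable \<mu> g"
  shows "L1_dist \<mu> (L1_class \<mu> f) (L1_class \<mu> g) = (LINT x|\<mu>. \<bar>f x - g x\<bar>)"
  unfolding L1_dist_def
proof (rule integral_cong_AE)
  show "AE x in \<mu>. \<bar>L1_rep (L1_class \<mu> f) x - L1_rep (L1_class \<mu> g) x\<bar> = \<bar>f x - g x\<bar>"
    using L1_rep_class(2)[OF f] L1_rep_class(2)[OF g] by eventually_elim simp
qed (use L1_rep_class(1)[OF f] L1_rep_class(1)[OF g] f g in auto)

lemma L1_space_cases:
  assumes "X \<in> L1_space \<mu>"
  obtains f where "integrable \<mu> f" "X = L1_class \<mu> f"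
  using assms by (auto simp: L1_space_eq)

lemma L1_zero_in_space [simp]: "L1_zero \<mu> \<in> L1_space \<mu>"
  by (simp add: L1_zero_def L1_class_in_space)

lemma L1_add_in_space [simp]:
  assumes "X \<in> L1_space \<mu>" "Y \<in> L1_space \<mu>"
  shows "L1_add \<mu> X Y \<in> L1_space \<mu>"
  using assms by (auto simp: L1_space_eq L1_add_class)

lemma L1_scale_in_space [simp]:
  assumes "X \<in> L1_space \<mu>"
  shows "L1_scale \<mu> c X \<in> L1_space \<mu>"
  using assms by (auto simp: L1_space_eq L1_scale_class)

lemma L1_norm_eq_dist:
  assumes "X \<in> L1_space \<mu>"
  shows "L1_norm \<mu> X = L1_dist \<mu> X (L1_zero \<mu>)"
  using assms by (auto elim!: L1_space_cases simp: L1_zero_def L1_norm_class L1_dist_class)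

lemma L1_dist_add:
  assumes "X \<in> L1_space \<mu>" "Y \<in> L1_space \<mu>" "X' \<in> L1_space \<mu>" "Y' \<in> L1_space \<mu>"
  shows "L1_dist \<mu> (L1_add \<mu> X Y) (L1_add \<mu> X' Y') \<le> L1_dist \<mu> X X' + L1_dist \<mu> Y Y'"
proof -
  obtain f g f' g' where i: "integrable \<mu> f" "integrable \<mu> g" "integrable \<mu> f'" "integrable \<mu> g'"
    and eq: "X = L1_class \<mu> f" "Y = L1_class \<mu> g" "X' = L1_class \<mu> f'" "Y' = L1_class \<mu> g'"
    using assms by (meson L1_space_cases)
  have "(LINT x|\<mu>. \<bar>f x + g x - (f' x + g' x)\<bar>) \<le> (LINT x|\<mu>. \<bar>f x - f' x\<bar> + \<bar>g x - g' x\<bar>)"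
    using i by (intro integral_mono) auto
  also have "\<dots> = (LINT x|\<mu>. \<bar>f x - f' x\<bar>) + (LINT x|\<mu>. \<bar>g x - g' x\<bar>)"
    using i by (intro Bochner_Integration.integral_add) auto
  finally show ?thesis
    using i by (simp add: eq L1_add_class L1_dist_class)
qed

lemma L1_dist_scale:
  assumes "X \<in> L1_space \<mu>" "Y \<in> L1_space \<mu>"
  shows "L1_dist \<mu> (L1_scale \<mu> c X) (L1_scale \<mu> c Y) = \<bar>c\<bar> * L1_dist \<mu> X Y"
proof -
  obtain f g where i: "integrable \<mu> f" "integrable \<mu> g"
    and eq: "X = L1_class \<mu> f" "Y = L1_class \<mu> g"
    using assms by (meson L1_space_cases)
  then show ?thesis
    by (simp add: L1_scale_class L1_dist_class abs_mult flip: right_diff_distrib)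
qed

text \<open>
  The Riesz--Fischer argument: a subsequence converges almost everywhere, and Fatou's lemma shows that
  its pointwise limit is the limit in the norm of the whole sequence.
\<close>

lemma L1_complete:
  assumes X: "\<And>n. X n \<in> L1_space \<mu>"
    and Cauchy: "\<And>e. e > 0 \<Longrightarrow> \<exists>N. \<forall>i\<ge>N. \<forall>j\<ge>N. L1_dist \<mu> (X i) (X j) < e"
  obtains Y where "Y \<in> L1_space \<mu>" "(\<lambda>n. L1_dist \<mu> (X n) Y) \<longlonglongrightarrow> 0"
proof -
  define s where "s n = L1_rep (X n)" for n
  have int_s [measurable]: "integrable \<mu> (s n)" for n
    using X by (simp add: s_def L1_rep_integrable)
  have X_s: "X n = L1_class \<mu> (s n)" for n
    using X by (simp add: s_def L1_class_rep)
  have C: "\<exists>N. \<forall>i\<ge>N. \<forall>j\<ge>N. (LINT x|\<mu>. \<bar>s i x - s j x\<bar>) < e" if "e > 0" for e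
    using Cauchy[OF that] unfolding X_s L1_dist_class[OF int_s int_s] .
  obtain r where r: "strict_mono r" and AE_C: "AE x in \<mu>. Cauchy (\<lambda>i. s (r i) x)"
    using cauchy_L1_AE_cauchy_subseq[of \<mu> s, OF int_s] C unfolding real_norm_def by blast
  define w where "w x = lim (\<lambda>i. s (r i) x)" for x
  have [measurable]: "w \<in> borel_measurable \<mu>"
    unfolding w_def by measurable
  have AE_lim: "AE x in \<mu>. (\<lambda>i. s (r i) x) \<longlonglongrightarrow> w x"
    using AE_C by eventually_elim (simp add: w_def Cauchy_convergent_iff convergent_LIMSEQ_iff)
  have bound: "(\<integral>\<^sup>+x. \<bar>s k x - w x\<bar> \<partial>\<mu>) \<le> ennreal e"
    if k: "k \<ge> N" and N: "\<forall>i\<ge>N. \<forall>j\<ge>N. (LINT x|\<mu>. \<bar>s i x - s j x\<bar>) < e" for k N e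
  proof -
    have "(\<integral>\<^sup>+x. \<bar>s k x - w x\<bar> \<partial>\<mu>) = (\<integral>\<^sup>+x. liminf (\<lambda>i. ennreal \<bar>s k x - s (r i) x\<bar>) \<partial>\<mu>)"
    proof (rule nn_integral_cong_AE)
      show "AE x in \<mu>. ennreal \<bar>s k x - w x\<bar> = liminf (\<lambda>i. ennreal \<bar>s k x - s (r i) x\<bar>)"
        using AE_lim
      proof eventually_elim
        case (elim x)
        then have "(\<lambda>i. ennreal \<bar>s k x - s (r i) x\<bar>) \<longlonglongrightarrow> ennreal \<bar>s k x - w x\<bar>"
          by (intro tendsto_intros) auto
        then show ?case
          by (rule lim_imp_Liminf[OF trivial_limit_sequentially, symmetric])
      qed
    qed
    also have "\<dots> \<le> liminf (\<lambda>i. \<integral>\<^sup>+x. ennreal \<bar>s k x - s (r i) x\<bar> \<partial>\<mu>)"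
      by (rule nn_integral_liminf) measurable
    also have "\<dots> \<le> ennreal e"
    proof (rule Liminf_le, simp)
      have "(\<integral>\<^sup>+x. ennreal \<bar>s k x - s (r i) x\<bar> \<partial>\<mu>) \<le> ennreal e" if "i \<ge> N" for i
      proof -
        have "r i \<ge> N"
          using that strict_mono_imp_increasing[OF r, of i] by simp
        then show ?thesis
          using N k int_s by (subst nn_integral_eq_integral) (auto intro!: ennreal_leI[OF less_imp_le])
      qed
      then show "\<forall>\<^sub>F i in sequentially. (\<integral>\<^sup>+x. ennreal \<bar>s k x - s (r i) x\<bar> \<partial>\<mu>) \<le> ennreal e"
        by (rule eventually_sequentiallyI)
    qed
    finally show ?thesis .
  qed
  obtain N where N: "\<forall>i\<ge>N. \<forall>j\<ge>N. (LINT x|\<mu>. \<bar>s i x - s j x\<bar>) < 1"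
    using C[of 1] by auto
  have "integrable \<mu> (\<lambda>x. s N x - w x)"
    using bound[OF order_refl N] by (intro integrableI_bounded) (auto intro: le_less_trans)
  then have "integrable \<mu> (\<lambda>x. s N x - (s N x - w x))"
    by (rule Bochner_Integration.integrable_diff[OF int_s])
  then have int_w [measurable]: "integrable \<mu> w"
    by simp
  show thesis
  proof
    show "L1_class \<mu> w \<in> L1_space \<mu>"
      by (simp add: L1_class_in_space int_w)
    show "(\<lambda>n. L1_dist \<mu> (X n) (L1_class \<mu> w)) \<longlonglongrightarrow> 0"
    proof (rule LIMSEQ_I)
      fix e :: real assume e: "e > 0"
      then obtain N where N: "\<forall>i\<ge>N. \<forall>j\<ge>N. (LINT x|\<mu>. \<bar>s i x - s j x\<bar>) < e / 2"
        using C[of "e / 2"] by auto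
      have "(LINT x|\<mu>. \<bar>s k x - w x\<bar>) < e" if "k \<ge> N" for k
      proof -
        have "ennreal (LINT x|\<mu>. \<bar>s k x - w x\<bar>) \<le> ennreal (e / 2)"
          using bound[OF that N] int_s int_w by (subst (asm) nn_integral_eq_integral) auto
        then show ?thesis
          using e by (simp add: ennreal_le_iff)
      qed
      then show "\<exists>N. \<forall>n\<ge>N. norm (L1_dist \<mu> (X n) (L1_class \<mu> w) - 0) < e"
        by (auto simp: X_s L1_dist_class[OF int_s int_w])
    qed
  qed
qed

section \<open>Closures of subspaces as sets of limits of sequences\<close>

abbreviation L1_lim :: "'w measure \<Rightarrow> (nat \<Rightarrow> ('w \<Rightarrow> real) set) \<Rightarrow> ('w \<Rightarrow> real) set \<Rightarrow> bool" where
  "L1_lim \<mu> v X \<equiv> (\<lambda>k. L1_dist \<mu> (v k) X) \<longlonglongrightarrow> 0"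

lemmas L1_dist_commute = Metric_space.commute[OF Metric_space_L1]
lemmas L1_dist_nonneg [simp] = Metric_space.nonneg[OF Metric_space_L1]
lemmas L1_dist_triangle = Metric_space.triangle[OF Metric_space_L1]
lemmas L1_dist_eq_0 = Metric_space.zero[OF Metric_space_L1]

lemma L1_lim_const: "X \<in> L1_space \<mu> \<Longrightarrow> L1_lim \<mu> (\<lambda>_. X) X"
  by (simp add: L1_dist_eq_0[THEN iffD2])

lemma L1_lim_unique:
  assumes "L1_lim \<mu> v X" "L1_lim \<mu> v Y" "\<And>k. v k \<in> L1_space \<mu>" "X \<in> L1_space \<mu>" "Y \<in> L1_space \<mu>"
  shows "X = Y"
proof -
  have "(\<lambda>k. L1_dist \<mu> (v k) X + L1_dist \<mu> (v k) Y) \<longlonglongrightarrow> 0"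
    using tendsto_add[OF assms(1,2)] by simp
  moreover have "L1_dist \<mu> X Y \<le> L1_dist \<mu> (v k) X + L1_dist \<mu> (v k) Y" for k
    using L1_dist_triangle[of X \<mu> "v k" Y] assms(3-5) by (simp add: L1_dist_commute[of \<mu> X "v k"])
  ultimately have "L1_dist \<mu> X Y \<le> 0"
    by (intro LIMSEQ_le_const) auto
  then show ?thesis
    using L1_dist_eq_0[OF assms(4,5)] L1_dist_nonneg[of \<mu> X Y] by linarith
qed

lemma L1_lim_dominated:
  assumes "(\<lambda>k. e k) \<longlonglongrightarrow> 0" "\<And>k. L1_dist \<mu> (v k) X \<le> e k"
  shows "L1_lim \<mu> v X"
  using assms by (intro tendsto_sandwich[OF _ _ tendsto_const assms(1)]) auto

lemma L1_lim_add:
  assumes "L1_lim \<mu> v X" "L1_lim \<mu> w Y" "\<And>k. v k \<in> L1_space \<mu>" "\<And>k. w k \<in> L1_space \<mu>"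
    "X \<in> L1_space \<mu>" "Y \<in> L1_space \<mu>"
  shows "L1_lim \<mu> (\<lambda>k. L1_add \<mu> (v k) (w k)) (L1_add \<mu> X Y)"
proof (rule L1_lim_dominated)
  show "(\<lambda>k. L1_dist \<mu> (v k) X + L1_dist \<mu> (w k) Y) \<longlonglongrightarrow> 0"
    using tendsto_add[OF assms(1,2)] by simp
qed (rule L1_dist_add[OF assms(3,4,5,6)])

lemma L1_lim_scale:
  assumes "L1_lim \<mu> v X" "\<And>k. v k \<in> L1_space \<mu>" "X \<in> L1_space \<mu>"
  shows "L1_lim \<mu> (\<lambda>k. L1_scale \<mu> c (v k)) (L1_scale \<mu> c X)"
  using tendsto_mult_left[OF assms(1), of "\<bar>c\<bar>"] assms(2-) by (simp add: L1_dist_scale)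

lemma L1_lim_norm:
  assumes "L1_lim \<mu> v X" "\<And>k. v k \<in> L1_space \<mu>" "X \<in> L1_space \<mu>"
  shows "(\<lambda>k. L1_norm \<mu> (v k)) \<longlonglongrightarrow> L1_norm \<mu> X"
proof (rule LIM_zero_cancel, rule Lim_null_comparison[OF always_eventually assms(1)], rule allI)
  fix k
  show "norm (L1_norm \<mu> (v k) - L1_norm \<mu> X) \<le> L1_dist \<mu> (v k) X"
    using L1_dist_triangle[OF assms(2)[of k] assms(3) L1_zero_in_space]
      L1_dist_triangle[OF assms(3) assms(2)[of k] L1_zero_in_space] L1_dist_commute[of \<mu> X "v k"]
    unfolding L1_norm_eq_dist[OF assms(3)] L1_norm_eq_dist[OF assms(2)] real_norm_def by linarith
qed

definition L1_closure :: "'w measure \<Rightarrow> ('w \<Rightarrow> real) set set \<Rightarrow> ('w \<Rightarrow> real) set set" where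
  "L1_closure \<mu> V = Abstract_Topology.closure_of (Metric_space.mtopology (L1_space \<mu>) (L1_dist \<mu>)) V"

lemma in_L1_closure_iff:
  assumes V: "V \<subseteq> L1_space \<mu>"
  shows "X \<in> L1_closure \<mu> V \<longleftrightarrow> X \<in> L1_space \<mu> \<and> (\<exists>v. (\<forall>k. v k \<in> V) \<and> L1_lim \<mu> v X)"
proof -
  interpret Metric_space "L1_space \<mu>" "L1_dist \<mu>" by (rule Metric_space_L1)
  have *: "X \<in> L1_closure \<mu> V \<longleftrightarrow> X \<in> L1_space \<mu> \<and> (\<forall>r>0. \<exists>Y\<in>V. L1_dist \<mu> Y X < r)"
    unfolding L1_closure_def metric_closure_of mem_Collect_eq in_mball commute[of X]
    using V by blast
  have "\<exists>v. (\<forall>k. v k \<in> V) \<and> L1_lim \<mu> v X" if "\<forall>r>0. \<exists>Y\<in>V. L1_dist \<mu> Y X < r"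
  proof -
    have "\<forall>k. \<exists>Y\<in>V. L1_dist \<mu> Y X < inverse (real (Suc k))"
      using that by (auto simp del: of_nat_Suc)
    then obtain v where v: "\<And>k. v k \<in> V" "\<And>k. L1_dist \<mu> (v k) X < inverse (real (Suc k))"
      by metis
    have "L1_lim \<mu> v X"
      using v(2) by (intro L1_lim_dominated[OF LIMSEQ_inverse_real_of_nat]) (auto intro: less_imp_le)
    with v show ?thesis by blast
  qed
  moreover have "\<exists>Y\<in>V. L1_dist \<mu> Y X < r" if "\<And>k. v k \<in> V" "L1_lim \<mu> v X" "r > 0" for v r
  proof -
    have "\<forall>\<^sub>F k in sequentially. L1_dist \<mu> (v k) X < r"
      using that order_tendstoD(2) by blast
    then show ?thesis
      using that(1) by (meson eventually_happens trivial_limit_sequentially)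
  qed
  ultimately show ?thesis
    unfolding * by blast
qed

definition L1_subspace :: "'w measure \<Rightarrow> ('w \<Rightarrow> real) set set \<Rightarrow> bool" where
  "L1_subspace \<mu> V \<longleftrightarrow> V \<subseteq> L1_space \<mu> \<and> L1_zero \<mu> \<in> V \<and>
     (\<forall>X\<in>V. \<forall>Y\<in>V. L1_add \<mu> X Y \<in> V) \<and> (\<forall>c. \<forall>X\<in>V. L1_scale \<mu> c X \<in> V)"

lemma L1_subspaceD:
  assumes "L1_subspace \<mu> V"
  shows "V \<subseteq> L1_space \<mu>" and "L1_zero \<mu> \<in> V"
    and "\<And>X Y. X \<in> V \<Longrightarrow> Y \<in> V \<Longrightarrow> L1_add \<mu> X Y \<in> V"
    and "\<And>c X. X \<in> V \<Longrightarrow> L1_scale \<mu> c X \<in> V"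
  using assms by (auto simp: L1_subspace_def)

lemma subset_L1_closure:
  assumes "V \<subseteq> L1_space \<mu>"
  shows "V \<subseteq> L1_closure \<mu> V"
proof
  fix X assume "X \<in> V"
  with assms L1_lim_const[of X \<mu>] show "X \<in> L1_closure \<mu> V"
    by (auto simp: in_L1_closure_iff[OF assms] intro!: exI[of _ "\<lambda>_. X"])
qed

lemma L1_closure_cases:
  assumes "X \<in> L1_closure \<mu> V" "V \<subseteq> L1_space \<mu>"
  obtains v where "\<And>k. v k \<in> V" "L1_lim \<mu> v X" "X \<in> L1_space \<mu>"
  using assms by (auto simp: in_L1_closure_iff)

lemma L1_closureI:
  assumes "V \<subseteq> L1_space \<mu>" "\<And>k. v k \<in> V" "L1_lim \<mu> v X" "X \<in> L1_space \<mu>"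
  shows "X \<in> L1_closure \<mu> V"
  using assms by (auto simp: in_L1_closure_iff)

lemma L1_closed_subspace_closure:
  assumes "L1_subspace \<mu> V"
  shows "L1_closed_subspace \<mu> (L1_closure \<mu> V)"
proof -
  note V = L1_subspaceD[OF assms]
  interpret Metric_space "L1_space \<mu>" "L1_dist \<mu>" by (rule Metric_space_L1)
  have "L1_add \<mu> X Y \<in> L1_closure \<mu> V" if X: "X \<in> L1_closure \<mu> V" and Y: "Y \<in> L1_closure \<mu> V" for X Y
  proof -
    obtain v where v: "\<And>k. v k \<in> V" "L1_lim \<mu> v X" "X \<in> L1_space \<mu>"
      using X V(1) by (rule L1_closure_cases) blast
    obtain w where w: "\<And>k. w k \<in> V" "L1_lim \<mu> w Y" "Y \<in> L1_space \<mu>"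
      using Y V(1) by (rule L1_closure_cases) blast
    have "L1_lim \<mu> (\<lambda>k. L1_add \<mu> (v k) (w k)) (L1_add \<mu> X Y)"
      using v w V(1) by (intro L1_lim_add) auto
    then show ?thesis
      by (rule L1_closureI[OF V(1), rotated]) (use v w V(3) in auto)
  qed
  moreover have "L1_scale \<mu> c X \<in> L1_closure \<mu> V" if X: "X \<in> L1_closure \<mu> V" for X c
  proof -
    obtain v where v: "\<And>k. v k \<in> V" "L1_lim \<mu> v X" "X \<in> L1_space \<mu>"
      using X V(1) by (rule L1_closure_cases) blast
    have "L1_lim \<mu> (\<lambda>k. L1_scale \<mu> c (v k)) (L1_scale \<mu> c X)"
      using v V(1) by (intro L1_lim_scale) auto
    then show ?thesis
      by (rule L1_closureI[OF V(1), rotated]) (use v V(4) in auto)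
  qed
  moreover have "L1_closure \<mu> V \<subseteq> L1_space \<mu>"
    using V(1) by (auto simp: in_L1_closure_iff)
  moreover have "L1_zero \<mu> \<in> L1_closure \<mu> V"
    using V(2) subset_L1_closure[OF V(1)] by blast
  moreover have "closedin mtopology (L1_closure \<mu> V)"
    by (simp add: L1_closure_def)
  ultimately show ?thesis
    unfolding L1_closed_subspace_def by blast
qed

section \<open>Extending a bounded action from a subspace to its closure\<close>

text \<open>
  The extension by continuity. Demanding the limit along every approximating sequence, rather than
  along one of them, makes the value independent of choices.
\<close>

definition L1_extension ::
  "'w measure \<Rightarrow> ('w \<Rightarrow> real) set set \<Rightarrow> (('w \<Rightarrow> real) set \<Rightarrow> ('w \<Rightarrow> real) set) \<Rightarrow>
   ('w \<Rightarrow> real) set \<Rightarrow> ('w \<Rightarrow> real) set" where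
  "L1_extension \<mu> V T X = (SOME Y. Y \<in> L1_space \<mu> \<and>
     (\<forall>v. (\<forall>k. v k \<in> V) \<longrightarrow> L1_lim \<mu> v X \<longrightarrow> L1_lim \<mu> (\<lambda>k. T (v k)) Y))"

locale L1_bounded_on_subspace =
  fixes \<mu> :: "'w measure" and V T and C :: real
  assumes subspace: "L1_subspace \<mu> V"
    and maps: "X \<in> V \<Longrightarrow> T X \<in> V"
    and additive: "X \<in> V \<Longrightarrow> Y \<in> V \<Longrightarrow> T (L1_add \<mu> X Y) = L1_add \<mu> (T X) (T Y)"
    and homogeneous: "X \<in> V \<Longrightarrow> T (L1_scale \<mu> c X) = L1_scale \<mu> c (T X)"
    and bounded: "X \<in> V \<Longrightarrow> L1_norm \<mu> (T X) \<le> C * L1_norm \<mu> X"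
    and bound_nonneg: "C \<ge> 0"
begin

lemmas V = L1_subspaceD[OF subspace]

lemma in_space [simp]: "X \<in> V \<Longrightarrow> X \<in> L1_space \<mu>"
  using V(1) by blast

lemma Lipschitz:
  assumes X: "X \<in> V" and Y: "Y \<in> V"
  shows "L1_dist \<mu> (T X) (T Y) \<le> C * L1_dist \<mu> X Y"
proof -
  have "L1_dist \<mu> (T X) (T Y) = L1_norm \<mu> (T (L1_add \<mu> X (L1_scale \<mu> (-1) Y)))"
    using X Y V(4) by (simp add: L1_dist_norm maps additive homogeneous)
  also have "\<dots> \<le> C * L1_norm \<mu> (L1_add \<mu> X (L1_scale \<mu> (-1) Y))"
    using X Y V(3,4) by (intro bounded) auto
  also have "\<dots> = C * L1_dist \<mu> X Y"
    using X Y by (simp add: L1_dist_norm)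
  finally show ?thesis .
qed

lemma Lipschitz_via:
  assumes X: "X \<in> V" and Y: "Y \<in> V" and Z: "Z \<in> L1_space \<mu>"
  shows "L1_dist \<mu> (T X) (T Y) \<le> C * (L1_dist \<mu> X Z + L1_dist \<mu> Y Z)"
proof -
  have "L1_dist \<mu> X Y \<le> L1_dist \<mu> X Z + L1_dist \<mu> Y Z"
    using L1_dist_triangle[OF in_space[OF X] Z in_space[OF Y]] L1_dist_commute[of \<mu> Z Y] by simp
  then show ?thesis
    using Lipschitz[OF X Y] mult_left_mono[OF _ bound_nonneg] by (meson order_trans)
qed

text \<open>
  The image of an approximating sequence is Cauchy because the operator is Lipschitz, so it has a limit
  by completeness. Any other approximating sequence has asymptotically the same images.
\<close>

lemma extension_exists:
  assumes "X \<in> L1_closure \<mu> V"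
  shows "\<exists>Y. Y \<in> L1_space \<mu> \<and>
     (\<forall>v. (\<forall>k. v k \<in> V) \<longrightarrow> L1_lim \<mu> v X \<longrightarrow> L1_lim \<mu> (\<lambda>k. T (v k)) Y)"
proof -
  obtain v where v: "\<And>k. v k \<in> V" "L1_lim \<mu> v X" "X \<in> L1_space \<mu>"
    using assms V(1) by (rule L1_closure_cases) blast
  have "\<exists>N. \<forall>i\<ge>N. \<forall>j\<ge>N. L1_dist \<mu> (T (v i)) (T (v j)) < e" if "e > 0" for e
  proof -
    have "(\<lambda>k. C * L1_dist \<mu> (v k) X) \<longlonglongrightarrow> 0"
      using tendsto_mult_left[OF v(2), of C] by simp
    then have "\<forall>\<^sub>F k in sequentially. C * L1_dist \<mu> (v k) X < e / 2"
      using that by (intro order_tendstoD(2)) auto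
    then obtain N where N: "\<And>k. k \<ge> N \<Longrightarrow> C * L1_dist \<mu> (v k) X < e / 2"
      by (auto simp: eventually_sequentially)
    have "L1_dist \<mu> (T (v i)) (T (v j)) < e" if "i \<ge> N" "j \<ge> N" for i j
      using Lipschitz_via[OF v(1) v(1) v(3), of i j] N[OF that(1)] N[OF that(2)]
      by (simp add: distrib_left)
    then show ?thesis by blast
  qed
  then obtain Y where Y: "Y \<in> L1_space \<mu>" "L1_lim \<mu> (\<lambda>k. T (v k)) Y"
    using L1_complete[of "\<lambda>k. T (v k)" \<mu>] v(1) maps in_space by metis
  have "L1_lim \<mu> (\<lambda>k. T (w k)) Y" if w: "\<And>k. w k \<in> V" "L1_lim \<mu> w X" for w
  proof (rule L1_lim_dominated)
    show "(\<lambda>k. C * (L1_dist \<mu> (w k) X + L1_dist \<mu> (v k) X) + L1_dist \<mu> (T (v k)) Y) \<longlonglongrightarrow> 0"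
      using tendsto_add[OF tendsto_mult_left[OF tendsto_add[OF w(2) v(2)], of C] Y(2)] by simp
    show "L1_dist \<mu> (T (w k)) Y
        \<le> C * (L1_dist \<mu> (w k) X + L1_dist \<mu> (v k) X) + L1_dist \<mu> (T (v k)) Y" for k
      using Lipschitz_via[OF w(1) v(1) v(3), of k k]
        L1_dist_triangle[of "T (w k)" \<mu> "T (v k)" Y] Y(1) in_space[OF maps[OF w(1)]] in_space[OF maps[OF v(1)]]
      by (smt (verit))
  qed
  with Y(1) show ?thesis by blast
qed

abbreviation "ext \<equiv> L1_extension \<mu> V T"

lemma extension_in_space [simp]: "X \<in> L1_closure \<mu> V \<Longrightarrow> ext X \<in> L1_space \<mu>"
  unfolding L1_extension_def using someI_ex[OF extension_exists] by blast

lemma extension_lim: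
  "X \<in> L1_closure \<mu> V \<Longrightarrow> (\<And>k. v k \<in> V) \<Longrightarrow> L1_lim \<mu> v X \<Longrightarrow> L1_lim \<mu> (\<lambda>k. T (v k)) (ext X)"
  unfolding L1_extension_def using someI_ex[OF extension_exists] by blast

lemma extension_eqI:
  assumes X: "X \<in> L1_closure \<mu> V" and Y: "Y \<in> L1_space \<mu>"
    and v: "\<And>k. v k \<in> V" "L1_lim \<mu> v X" "L1_lim \<mu> (\<lambda>k. T (v k)) Y"
  shows "ext X = Y"
  using extension_lim[OF X v(1,2)] v(3) in_space[OF maps[OF v(1)]] extension_in_space[OF X] Y
  by (rule L1_lim_unique)

lemma extension_eq: "X \<in> V \<Longrightarrow> ext X = T X"
  using subset_L1_closure[OF V(1)] maps
  by (intro extension_eqI[of X "T X" "\<lambda>_. X"]) (auto intro!: L1_lim_const)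

lemma extension_in_closure:
  assumes X: "X \<in> L1_closure \<mu> V"
  shows "ext X \<in> L1_closure \<mu> V"
proof -
  obtain v where v: "\<And>k. v k \<in> V" "L1_lim \<mu> v X" "X \<in> L1_space \<mu>"
    using X V(1) by (rule L1_closure_cases) blast
  show ?thesis
    by (rule L1_closureI[OF V(1) maps[OF v(1)] extension_lim[OF X v(1,2)] extension_in_space[OF X]])
qed

lemma extension_add:
  assumes X: "X \<in> L1_closure \<mu> V" and Y: "Y \<in> L1_closure \<mu> V"
  shows "ext (L1_add \<mu> X Y) = L1_add \<mu> (ext X) (ext Y)"
proof -
  obtain v where v: "\<And>k. v k \<in> V" "L1_lim \<mu> v X" "X \<in> L1_space \<mu>"
    using X V(1) by (rule L1_closure_cases) blast
  obtain w where w: "\<And>k. w k \<in> V" "L1_lim \<mu> w Y" "Y \<in> L1_space \<mu>"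
    using Y V(1) by (rule L1_closure_cases) blast
  show ?thesis
  proof (rule extension_eqI)
    show "L1_add \<mu> X Y \<in> L1_closure \<mu> V"
      using L1_closed_subspace_closure[OF subspace] X Y by (auto simp: L1_closed_subspace_def)
    show "L1_lim \<mu> (\<lambda>k. L1_add \<mu> (v k) (w k)) (L1_add \<mu> X Y)"
      using v w by (intro L1_lim_add) auto
    have "L1_lim \<mu> (\<lambda>k. L1_add \<mu> (T (v k)) (T (w k))) (L1_add \<mu> (ext X) (ext Y))"
      using v w X Y maps extension_lim by (intro L1_lim_add) auto
    then show "L1_lim \<mu> (\<lambda>k. T (L1_add \<mu> (v k) (w k))) (L1_add \<mu> (ext X) (ext Y))"
      using v w by (simp add: additive)
  qed (use v w X Y V(3) in auto)
qed

lemma extension_scale: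
  assumes X: "X \<in> L1_closure \<mu> V"
  shows "ext (L1_scale \<mu> c X) = L1_scale \<mu> c (ext X)"
proof -
  obtain v where v: "\<And>k. v k \<in> V" "L1_lim \<mu> v X" "X \<in> L1_space \<mu>"
    using X V(1) by (rule L1_closure_cases) blast
  show ?thesis
  proof (rule extension_eqI)
    show "L1_scale \<mu> c X \<in> L1_closure \<mu> V"
      using L1_closed_subspace_closure[OF subspace] X by (auto simp: L1_closed_subspace_def)
    show "L1_lim \<mu> (\<lambda>k. L1_scale \<mu> c (v k)) (L1_scale \<mu> c X)"
      using v by (intro L1_lim_scale) auto
    have "L1_lim \<mu> (\<lambda>k. L1_scale \<mu> c (T (v k))) (L1_scale \<mu> c (ext X))"
      using v X maps extension_lim by (intro L1_lim_scale) auto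
    then show "L1_lim \<mu> (\<lambda>k. T (L1_scale \<mu> c (v k))) (L1_scale \<mu> c (ext X))"
      using v by (simp add: homogeneous)
  qed (use v X V(4) in auto)
qed

lemma extension_norm_le:
  assumes X: "X \<in> L1_closure \<mu> V"
  shows "L1_norm \<mu> (ext X) \<le> C * L1_norm \<mu> X"
proof -
  obtain v where v: "\<And>k. v k \<in> V" "L1_lim \<mu> v X" "X \<in> L1_space \<mu>"
    using X V(1) by (rule L1_closure_cases) blast
  have "(\<lambda>k. L1_norm \<mu> (T (v k))) \<longlonglongrightarrow> L1_norm \<mu> (ext X)"
    using v X maps by (intro L1_lim_norm extension_lim) auto
  moreover have "(\<lambda>k. C * L1_norm \<mu> (v k)) \<longlonglongrightarrow> C * L1_norm \<mu> X"
    using v by (intro tendsto_mult_left L1_lim_norm) auto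
  ultimately show ?thesis
    using bounded v(1) by (intro LIMSEQ_le) auto
qed

end

text \<open>
  Both sides of each law of a representation are limits of the same sequence, along any sequence from
  \<open>V\<close> that approximates the argument.
\<close>

lemma L1_representation_extension:
  fixes G (structure)
  assumes G: "group G"
    and T: "\<And>s. s \<in> carrier G \<Longrightarrow> L1_bounded_on_subspace \<mu> V (T s) C"
    and T_one: "\<And>X. X \<in> V \<Longrightarrow> T \<one> X = X"
    and T_mult: "\<And>s t X. s \<in> carrier G \<Longrightarrow> t \<in> carrier G \<Longrightarrow> X \<in> V \<Longrightarrow> T (s \<otimes> t) X = T s (T t X)"
  defines "E \<equiv> L1_closure \<mu> V" and "\<pi> \<equiv> \<lambda>s. L1_extension \<mu> V (T s)"
  shows "L1_representation G \<mu> E \<pi>" and "L1_uniformly_bounded G \<mu> E \<pi>"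
proof -
  interpret group G by (rule G)
  interpret one: L1_bounded_on_subspace \<mu> V "T \<one>" C
    by (rule T) simp
  have closed: "L1_closed_subspace \<mu> E"
    unfolding E_def by (rule L1_closed_subspace_closure) (rule one.subspace)
  have norm: "L1_norm \<mu> (\<pi> s X) \<le> C * L1_norm \<mu> X" if "s \<in> carrier G" "X \<in> E" for s X
    using L1_bounded_on_subspace.extension_norm_le[OF T] that by (simp add: E_def \<pi>_def)
  have "L1_bounded_operator \<mu> E (\<pi> s)" if "s \<in> carrier G" for s
  proof -
    interpret L1_bounded_on_subspace \<mu> V "T s" C
      using that by (rule T)
    show ?thesis
      unfolding L1_bounded_operator_def using norm[OF that]
      by (auto simp: E_def \<pi>_def extension_in_closure extension_add extension_scale)
  qed
  moreover have "\<pi> \<one> X = X" if X: "X \<in> E" for X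
  proof -
    obtain v where v: "\<And>k. v k \<in> V" "L1_lim \<mu> v X" "X \<in> L1_space \<mu>"
      using X one.V(1) unfolding E_def by (rule L1_closure_cases) blast
    then show ?thesis
      unfolding \<pi>_def using X by (intro one.extension_eqI[of X X v]) (auto simp: T_one E_def)
  qed
  moreover have "\<pi> (s \<otimes> t) X = \<pi> s (\<pi> t X)"
    if s: "s \<in> carrier G" and t: "t \<in> carrier G" and X: "X \<in> E" for s t X
  proof -
    interpret s: L1_bounded_on_subspace \<mu> V "T s" C using s by (rule T)
    interpret t: L1_bounded_on_subspace \<mu> V "T t" C using t by (rule T)
    interpret st: L1_bounded_on_subspace \<mu> V "T (s \<otimes> t)" C by (rule T) (simp add: s t)
    obtain v where v: "\<And>k. v k \<in> V" "L1_lim \<mu> v X" "X \<in> L1_space \<mu>"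
      using X one.V(1) unfolding E_def by (rule L1_closure_cases) blast
    have "L1_lim \<mu> (\<lambda>k. T s (T t (v k))) (\<pi> s (\<pi> t X))"
      unfolding \<pi>_def using X v t.maps
      by (intro s.extension_lim t.extension_lim t.extension_in_closure) (auto simp: E_def)
    then show ?thesis
      unfolding \<pi>_def using X v s t
      by (intro st.extension_eqI[of X _ v]) (auto simp: E_def T_mult s.extension_in_space t.extension_in_closure)
  qed
  ultimately show "L1_representation G \<mu> E \<pi>"
    by (simp add: L1_representation_def)
  show "L1_uniformly_bounded G \<mu> E \<pi>"
    unfolding L1_uniformly_bounded_def
  proof (rule bdd_aboveI2)
    fix s assume s: "s \<in> carrier G"
    have "L1_norm \<mu> (\<pi> s X) \<le> C" if "X \<in> E" "L1_norm \<mu> X \<le> 1" for X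
      using norm[OF s that(1)] mult_left_mono[OF that(2) one.bound_nonneg] by simp
    moreover have "L1_zero \<mu> \<in> {X \<in> E. L1_norm \<mu> X \<le> 1}"
      using closed by (simp add: L1_closed_subspace_def L1_zero_def L1_norm_class)
    ultimately show "L1_operator_norm \<mu> E (\<pi> s) \<le> C"
      unfolding L1_operator_norm_def by (intro cSUP_least) auto
  qed
qed

section \<open>Combinations with finitely supported coefficients\<close>

text \<open>
  The functions of interest have finite support; for any other function both sums below are \<open>0\<close> by
  default.
\<close>

definition lin_comb :: "('a \<Rightarrow> 'v::real_vector) \<Rightarrow> ('a \<Rightarrow> real) \<Rightarrow> 'v" where
  "lin_comb h a = (\<Sum>t | a t \<noteq> 0. a t *\<^sub>R h t)"

definition l1_norm :: "('a \<Rightarrow> real) \<Rightarrow> real" where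
  "l1_norm a = (\<Sum>t | a t \<noteq> 0. \<bar>a t\<bar>)"

lemma lin_comb_superset:
  assumes "finite S" "{t. a t \<noteq> 0} \<subseteq> S"
  shows "lin_comb h a = (\<Sum>t\<in>S. a t *\<^sub>R h t)"
  unfolding lin_comb_def using assms by (intro sum.mono_neutral_left) auto

lemma l1_norm_superset:
  assumes "finite S" "{t. a t \<noteq> 0} \<subseteq> S"
  shows "l1_norm a = (\<Sum>t\<in>S. \<bar>a t\<bar>)"
  unfolding l1_norm_def using assms by (intro sum.mono_neutral_left) auto

lemma lin_comb_add:
  assumes "finite {t. a t \<noteq> 0}" "finite {t. b t \<noteq> 0}"
  shows "lin_comb h (\<lambda>t. a t + b t) = lin_comb h a + lin_comb h b"
proof -
  let ?S = "{t. a t \<noteq> 0} \<union> {t. b t \<noteq> 0}"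
  have "lin_comb h c = (\<Sum>t\<in>?S. c t *\<^sub>R h t)" if "c \<in> {a, b, \<lambda>t. a t + b t}" for c
    using assms that by (intro lin_comb_superset) auto
  then show ?thesis
    by (simp add: scaleR_left_distrib sum.distrib)
qed

lemma lin_comb_scale: "lin_comb h (\<lambda>t. c * a t) = c *\<^sub>R lin_comb h a"
  by (cases "c = 0") (simp_all add: lin_comb_def scaleR_sum_right)

lemma lin_comb_point_difference:
  "lin_comb h (\<lambda>t. of_bool (t = x) - of_bool (t = y)) = h x - h y"
proof -
  have "lin_comb h (\<lambda>t. of_bool (t = x) - of_bool (t = y))
      = (\<Sum>t\<in>{x, y}. (of_bool (t = x) - of_bool (t = y)) *\<^sub>R h t)"
    by (rule lin_comb_superset) auto
  then show ?thesis
    by (cases "x = y") auto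
qed

lemma L1_realisation:
  fixes f :: "'g \<Rightarrow> 'h::real_inner"
  assumes "countable A"
  obtains g :: "'g \<Rightarrow> (nat \<Rightarrow> real) \<Rightarrow> real"
  where "\<And>t. integrable tagged_gaussian (g t)"
    and "\<And>a. finite {t. a t \<noteq> 0} \<Longrightarrow> {t. a t \<noteq> 0} \<subseteq> A \<Longrightarrow>
      (LINT y|tagged_gaussian. \<bar>lin_comb (\<lambda>t. g t y) a\<bar>) = norm (lin_comb f a) + l1_norm a"
proof
  define v where "v k = f (from_nat_into A k)" for k
  define g where "g t = tagged_vector v (to_nat_on A t)" for t
  show "integrable tagged_gaussian (g t)" for t
    unfolding g_def by (rule integrable_tagged_vector)
  fix a :: "'g \<Rightarrow> real"
  assume fin: "finite {t. a t \<noteq> 0}" and sub: "{t. a t \<noteq> 0} \<subseteq> A"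
  define S where "S = {t. a t \<noteq> 0}"
  define a' where "a' k = a (from_nat_into A k)" for k
  have inj: "inj_on (to_nat_on A) S"
    using inj_on_to_nat_on[OF assms] sub by (auto simp: S_def intro: inj_on_subset)
  have inv: "from_nat_into A (to_nat_on A t) = t" if "t \<in> S" for t
    using that sub assms by (auto simp: S_def)
  have "(LINT y|tagged_gaussian. \<bar>\<Sum>k\<in>to_nat_on A ` S. a' k * tagged_vector v k y\<bar>)
      = norm (\<Sum>k\<in>to_nat_on A ` S. a' k *\<^sub>R v k) + (\<Sum>k\<in>to_nat_on A ` S. \<bar>a' k\<bar>)"
    using fin by (intro integral_tagged_combination) (simp add: S_def)
  then show "(LINT y|tagged_gaussian. \<bar>lin_comb (\<lambda>t. g t y) a\<bar>) = norm (lin_comb f a) + l1_norm a"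
    by (simp add: sum.reindex[OF inj] a'_def inv v_def g_def lin_comb_def l1_norm_def S_def[symmetric])
qed

definition zero_sum :: "'a set \<Rightarrow> ('a \<Rightarrow> real) set" where
  "zero_sum A = {a. finite {t. a t \<noteq> 0} \<and> {t. a t \<noteq> 0} \<subseteq> A \<and> lin_comb (\<lambda>_. 1 :: real) a = 0}"

lemma zero_sum_0: "(\<lambda>_. 0) \<in> zero_sum A"
  by (simp add: zero_sum_def lin_comb_def)

lemma zero_sum_add:
  assumes "a \<in> zero_sum A" "b \<in> zero_sum A"
  shows "(\<lambda>t. a t + b t) \<in> zero_sum A"
proof -
  have "{t. a t + b t \<noteq> 0} \<subseteq> {t. a t \<noteq> 0} \<union> {t. b t \<noteq> 0}" by auto
  with assms show ?thesis
    by (auto simp: zero_sum_def lin_comb_add intro: finite_subset)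
qed

lemma zero_sum_scale:
  assumes "a \<in> zero_sum A"
  shows "(\<lambda>t. c * a t) \<in> zero_sum A"
  using assms lin_comb_scale[of "\<lambda>_. 1 :: real" c a] by (cases "c = 0") (auto simp: zero_sum_def)

lemma zero_sum_point_difference:
  assumes "x \<in> A" "y \<in> A"
  shows "(\<lambda>t. of_bool (t = x) - of_bool (t = y)) \<in> zero_sum A"
proof -
  have "{t. (of_bool (t = x) - of_bool (t = y) :: real) \<noteq> 0} \<subseteq> {x, y}" by auto
  with assms show ?thesis
    by (auto simp: zero_sum_def lin_comb_point_difference intro: finite_subset)
qed

lemma l1_norm_point_difference:
  assumes "x \<noteq> y"
  shows "l1_norm (\<lambda>t. of_bool (t = x) - of_bool (t = y)) = 2"
  using assms by (subst l1_norm_superset[of "{x, y}"]) auto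

section \<open>Perturbing squared distances\<close>

text \<open>
  Expanding \<open>norm (h t - h u)^2\<close>, the two square terms contribute a multiple of the total sum of \<open>a\<close>,
  which is \<open>0\<close>, and only the mixed term survives.
\<close>

lemma norm_lin_comb_zero_sum:
  fixes h :: "'a \<Rightarrow> 'v::real_inner"
  assumes "lin_comb (\<lambda>_. 1 :: real) a = 0"
  defines "S \<equiv> {t. a t \<noteq> 0}"
  shows "2 * (norm (lin_comb h a))\<^sup>2 = - (\<Sum>t\<in>S. \<Sum>u\<in>S. a t * a u * (norm (h t - h u))\<^sup>2)"
proof -
  have zero: "(\<Sum>t\<in>S. a t) = 0"
    using assms by (simp add: lin_comb_def)
  have "a t * a u * (norm (h t - h u))\<^sup>2
      = (a t * (h t \<bullet> h t)) * a u + a t * (a u * (h u \<bullet> h u)) - 2 * ((a t *\<^sub>R h t) \<bullet> (a u *\<^sub>R h u))" for t u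
    by (simp add: power2_norm_eq_inner inner_diff_left inner_diff_right inner_commute algebra_simps)
  then have "(\<Sum>t\<in>S. \<Sum>u\<in>S. a t * a u * (norm (h t - h u))\<^sup>2)
      = (\<Sum>t\<in>S. a t * (h t \<bullet> h t)) * (\<Sum>u\<in>S. a u) + (\<Sum>t\<in>S. a t) * (\<Sum>u\<in>S. a u * (h u \<bullet> h u))
        - 2 * (\<Sum>t\<in>S. \<Sum>u\<in>S. (a t *\<^sub>R h t) \<bullet> (a u *\<^sub>R h u))"
    by (simp only: sum.distrib sum_subtractf sum_product) (simp only: sum_distrib_left)
  also have "\<dots> = - 2 * (norm (lin_comb h a))\<^sup>2"
    unfolding zero lin_comb_def power2_norm_eq_inner S_def[symmetric] inner_sum_left
    unfolding inner_sum_right by simp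
  finally show ?thesis by simp
qed

text \<open>
  The norm of a combination of total sum zero depends on the squared distances only, and linearly so
  after squaring. Perturbing the squared distances by at most \<open>M\<close> therefore raises the squared norm by at
  most \<open>M / 2\<close> times the square of the \<open>\<ell>\<^sup>1\<close> norm of the coefficients.
\<close>

lemma norm_lin_comb_perturbed:
  fixes h :: "'a \<Rightarrow> 'v::real_inner" and h' :: "'a \<Rightarrow> 'w::real_inner"
  assumes "lin_comb (\<lambda>_. 1 :: real) a = 0" and "M \<ge> 0"
    and close: "\<And>t u. a t \<noteq> 0 \<Longrightarrow> a u \<noteq> 0 \<Longrightarrow> (norm (h t - h u))\<^sup>2 \<le> (norm (h' t - h' u))\<^sup>2 + M"
      "\<And>t u. a t \<noteq> 0 \<Longrightarrow> a u \<noteq> 0 \<Longrightarrow> (norm (h' t - h' u))\<^sup>2 \<le> (norm (h t - h u))\<^sup>2 + M"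
  shows "norm (lin_comb h' a) \<le> norm (lin_comb h a) + sqrt (M / 2) * l1_norm a"
proof -
  define S where "S = {t. a t \<noteq> 0}"
  have l1: "l1_norm a \<ge> 0"
    by (simp add: l1_norm_def sum_nonneg)
  have "2 * (norm (lin_comb h' a))\<^sup>2 - 2 * (norm (lin_comb h a))\<^sup>2
      = (\<Sum>t\<in>S. \<Sum>u\<in>S. a t * a u * ((norm (h t - h u))\<^sup>2 - (norm (h' t - h' u))\<^sup>2))"
    unfolding norm_lin_comb_zero_sum[OF assms(1)] S_def[symmetric]
    by (simp add: right_diff_distrib sum_subtractf)
  also have "\<dots> \<le> (\<Sum>t\<in>S. \<Sum>u\<in>S. \<bar>a t\<bar> * \<bar>a u\<bar> * M)"
  proof (intro sum_mono)
    fix t u assume "t \<in> S" "u \<in> S"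
    then have "\<bar>(norm (h t - h u))\<^sup>2 - (norm (h' t - h' u))\<^sup>2\<bar> \<le> M"
      using close[of t u] by (simp add: S_def abs_le_iff)
    then have "\<bar>a t * a u * ((norm (h t - h u))\<^sup>2 - (norm (h' t - h' u))\<^sup>2)\<bar> \<le> \<bar>a t\<bar> * \<bar>a u\<bar> * M"
      unfolding abs_mult by (intro mult_left_mono) auto
    then show "a t * a u * ((norm (h t - h u))\<^sup>2 - (norm (h' t - h' u))\<^sup>2) \<le> \<bar>a t\<bar> * \<bar>a u\<bar> * M"
      by linarith
  qed
  also have "\<dots> = M * (l1_norm a)\<^sup>2"
    by (simp add: l1_norm_def S_def[symmetric] power2_eq_square sum_product sum_distrib_left mult_ac)
  also have "M * (l1_norm a)\<^sup>2 = 2 * (sqrt (M / 2) * l1_norm a)\<^sup>2"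
    using assms(2) by (simp add: power_mult_distrib)
  finally have "(norm (lin_comb h' a))\<^sup>2 \<le> (norm (lin_comb h a))\<^sup>2 + (sqrt (M / 2) * l1_norm a)\<^sup>2"
    by simp
  also have "\<dots> \<le> (norm (lin_comb h a) + sqrt (M / 2) * l1_norm a)\<^sup>2"
    using l1 assms(2) by (simp add: power2_sum)
  finally show ?thesis
    by (rule power2_le_imp_le) (use l1 assms(2) in auto)
qed

section \<open>The translation action and its cocycle\<close>

text \<open>
  The functions \<open>g t\<close> play the part of point masses: the \<open>L\<^sup>1\<close> norm of their combinations is the sum of the
  Hilbert norm and the \<open>\<ell>\<^sup>1\<close> norm.
\<close>

locale almost_isometric_map = group G for G (structure) +
  fixes f :: "'a \<Rightarrow> 'h::real_inner" and M :: real
    and g :: "'a \<Rightarrow> 'w \<Rightarrow> real" and \<mu> :: "'w measure"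
  assumes M_nonneg: "M \<ge> 0"
    and almost_isometric: "s \<in> carrier G \<Longrightarrow> x \<in> carrier G \<Longrightarrow> y \<in> carrier G \<Longrightarrow>
      (norm (f (s \<otimes> x) - f (s \<otimes> y)))\<^sup>2 \<le> (norm (f x - f y))\<^sup>2 + M"
    and g_integrable: "integrable \<mu> (g t)"
    and g_norm: "finite {t. a t \<noteq> 0} \<Longrightarrow> {t. a t \<noteq> 0} \<subseteq> carrier G \<Longrightarrow>
      (LINT y|\<mu>. \<bar>lin_comb (\<lambda>t. g t y) a\<bar>) = norm (lin_comb f a) + l1_norm a"
begin

abbreviation "D \<equiv> zero_sum (carrier G)"

definition vec :: "('a \<Rightarrow> real) \<Rightarrow> ('w \<Rightarrow> real) set" where
  "vec a = L1_class \<mu> (\<lambda>y. lin_comb (\<lambda>t. g t y) a)"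

lemma lin_comb_g_integrable: "integrable \<mu> (\<lambda>y. lin_comb (\<lambda>t. g t y) a)"
  unfolding lin_comb_def real_scaleR_def
  by (intro Bochner_Integration.integrable_sum integrable_mult_right g_integrable)

lemma vec_in_space: "vec a \<in> L1_space \<mu>"
  unfolding vec_def by (intro L1_class_in_space lin_comb_g_integrable)

lemma vec_add: "a \<in> D \<Longrightarrow> b \<in> D \<Longrightarrow> vec (\<lambda>t. a t + b t) = L1_add \<mu> (vec a) (vec b)"
  by (simp add: vec_def L1_add_class lin_comb_g_integrable lin_comb_add zero_sum_def)

lemma vec_scale: "vec (\<lambda>t. c * a t) = L1_scale \<mu> c (vec a)"
  by (simp add: vec_def L1_scale_class lin_comb_g_integrable lin_comb_scale)

lemma vec_norm: "a \<in> D \<Longrightarrow> L1_norm \<mu> (vec a) = norm (lin_comb f a) + l1_norm a"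
  by (simp add: vec_def L1_norm_class lin_comb_g_integrable g_norm zero_sum_def)

text \<open>
  The \<open>\<ell>\<^sup>1\<close> summand of the norm separates coefficient functions, even where the vectors \<open>f t\<close> are linearly
  dependent. Translation of coefficients is thus well defined on classes.
\<close>

lemma inj_on_vec: "inj_on vec D"
proof (rule inj_onI)
  fix a b assume ab: "a \<in> D" "b \<in> D" and eq: "vec a = vec b"
  define c where "c t = a t + (-1) * b t" for t
  have c: "c \<in> D"
    unfolding c_def using ab by (intro zero_sum_add zero_sum_scale)
  have "vec c = L1_add \<mu> (vec a) (L1_scale \<mu> (-1) (vec b))"
    unfolding c_def vec_add[OF ab(1) zero_sum_scale[OF ab(2)]] vec_scale ..
  then have "L1_norm \<mu> (vec c) = 0"
    using vec_in_space[of b] Metric_space.mdist_zero[OF Metric_space_L1, of "vec b" \<mu>]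
    by (simp add: eq flip: L1_dist_norm)
  then have "l1_norm c = 0"
    using vec_norm[OF c] norm_ge_zero[of "lin_comb f c"] by (simp add: l1_norm_def sum_nonneg add_nonneg_eq_0_iff)
  then have "c t = 0" for t
    using c by (auto simp: l1_norm_def sum_nonneg_eq_0_iff zero_sum_def)
  then show "a = b"
    by (auto simp: c_def)
qed

definition shift :: "'a \<Rightarrow> ('a \<Rightarrow> real) \<Rightarrow> 'a \<Rightarrow> real" where
  "shift s a t = (if t \<in> carrier G then a (inv s \<otimes> t) else 0)"

lemma support_shift:
  assumes "s \<in> carrier G" "a \<in> D"
  shows "{t. shift s a t \<noteq> 0} = (\<lambda>t. s \<otimes> t) ` {t. a t \<noteq> 0}"
proof -
  have sub: "{t. a t \<noteq> 0} \<subseteq> carrier G"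
    using assms by (simp add: zero_sum_def)
  show ?thesis
  proof (intro equalityI subsetI)
    fix t assume "t \<in> {t. shift s a t \<noteq> 0}"
    then have "t = s \<otimes> (inv s \<otimes> t)" "a (inv s \<otimes> t) \<noteq> 0"
      using assms by (auto simp: shift_def inv_solve_left' m_assoc[symmetric] split: if_splits)
    then show "t \<in> (\<lambda>t. s \<otimes> t) ` {t. a t \<noteq> 0}" by blast
  next
    fix t assume "t \<in> (\<lambda>t. s \<otimes> t) ` {t. a t \<noteq> 0}"
    then obtain u where "t = s \<otimes> u" "a u \<noteq> 0" "u \<in> carrier G"
      using sub by blast
    then show "t \<in> {t. shift s a t \<noteq> 0}"
      using assms by (simp add: shift_def m_assoc[symmetric])
  qed
qed

lemma sum_shift:
  assumes "s \<in> carrier G" "a \<in> D"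
  shows "(\<Sum>t | shift s a t \<noteq> 0. F (shift s a t) t) = (\<Sum>t | a t \<noteq> 0. F (a t) (s \<otimes> t))"
proof -
  have sub: "{t. a t \<noteq> 0} \<subseteq> carrier G"
    using assms by (simp add: zero_sum_def)
  have inj: "inj_on (\<lambda>t. s \<otimes> t) {t. a t \<noteq> 0}"
    using sub assms(1) by (intro inj_onI) (auto simp: subset_iff)
  show ?thesis
    unfolding support_shift[OF assms] sum.reindex[OF inj] o_def
    using sub assms by (intro sum.cong) (auto simp: shift_def m_assoc[symmetric])
qed

lemma lin_comb_shift:
  "s \<in> carrier G \<Longrightarrow> a \<in> D \<Longrightarrow> lin_comb h (shift s a) = lin_comb (\<lambda>t. h (s \<otimes> t)) a"
  unfolding lin_comb_def by (rule sum_shift)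

lemma l1_norm_shift: "s \<in> carrier G \<Longrightarrow> a \<in> D \<Longrightarrow> l1_norm (shift s a) = l1_norm a"
  unfolding l1_norm_def by (rule sum_shift)

lemma shift_in: "s \<in> carrier G \<Longrightarrow> a \<in> D \<Longrightarrow> shift s a \<in> D"
  using support_shift[of s a] lin_comb_shift[of s a "\<lambda>_. 1 :: real"]
  by (auto simp: zero_sum_def)

lemma shift_one: "a \<in> D \<Longrightarrow> shift \<one> a = a"
  by (auto simp: shift_def zero_sum_def fun_eq_iff)

lemma shift_mult: "s \<in> carrier G \<Longrightarrow> t \<in> carrier G \<Longrightarrow> shift (s \<otimes> t) a = shift s (shift t a)"
  by (auto simp: shift_def fun_eq_iff inv_mult_group m_assoc)

lemma shift_add: "shift s (\<lambda>t. a t + b t) = (\<lambda>t. shift s a t + shift s b t)"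
  by (auto simp: shift_def)

lemma shift_scale: "shift s (\<lambda>t. c * a t) = (\<lambda>t. c * shift s a t)"
  by (auto simp: shift_def)

text \<open>
  The hypothesis for the inverse of \<open>s\<close> bounds the squared distances from the other side, so that the
  perturbation is two-sided.
\<close>

lemma vec_shift_norm_le:
  assumes s: "s \<in> carrier G" and a: "a \<in> D"
  shows "L1_norm \<mu> (vec (shift s a)) \<le> (1 + sqrt (M / 2)) * L1_norm \<mu> (vec a)"
proof -
  have "norm (lin_comb (\<lambda>t. f (s \<otimes> t)) a) \<le> norm (lin_comb f a) + sqrt (M / 2) * l1_norm a"
  proof (rule norm_lin_comb_perturbed)
    fix t u assume "a t \<noteq> 0" "a u \<noteq> 0"
    then have t: "t \<in> carrier G" and u: "u \<in> carrier G"
      using a by (auto simp: zero_sum_def)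
    show "(norm (f (s \<otimes> t) - f (s \<otimes> u)))\<^sup>2 \<le> (norm (f t - f u))\<^sup>2 + M"
      using s t u by (rule almost_isometric)
    show "(norm (f t - f u))\<^sup>2 \<le> (norm (f (s \<otimes> t) - f (s \<otimes> u)))\<^sup>2 + M"
      using almost_isometric[of "inv s" "s \<otimes> t" "s \<otimes> u"] s t u by (simp add: m_assoc[symmetric])
  qed (use a M_nonneg in \<open>auto simp: zero_sum_def\<close>)
  moreover have "0 \<le> sqrt (M / 2) * norm (lin_comb f a)"
    using M_nonneg by simp
  ultimately show ?thesis
    using s a by (simp add: vec_norm shift_in lin_comb_shift l1_norm_shift algebra_simps)
qed

definition V :: "('w \<Rightarrow> real) set set" where
  "V = vec ` D"

definition T :: "'a \<Rightarrow> ('w \<Rightarrow> real) set \<Rightarrow> ('w \<Rightarrow> real) set" where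
  "T s X = vec (shift s (inv_into D vec X))"

lemma T_vec: "a \<in> D \<Longrightarrow> T s (vec a) = vec (shift s a)"
  by (simp add: T_def inv_into_f_f[OF inj_on_vec])

lemma subspace_V: "L1_subspace \<mu> V"
proof -
  have "L1_zero \<mu> = vec (\<lambda>_. 0)"
    by (simp add: L1_zero_def vec_def lin_comb_def)
  then show ?thesis
    by (auto simp: L1_subspace_def V_def vec_in_space zero_sum_0
        vec_add[symmetric] vec_scale[symmetric] intro!: imageI zero_sum_add zero_sum_scale)
qed

lemma T_bounded:
  assumes s: "s \<in> carrier G"
  shows "L1_bounded_on_subspace \<mu> V (T s) (1 + sqrt (M / 2))"
proof
  show "T s X \<in> V" if "X \<in> V" for X
    using that s by (auto simp: V_def T_vec shift_in)
  show "T s (L1_add \<mu> X Y) = L1_add \<mu> (T s X) (T s Y)" if "X \<in> V" "Y \<in> V" for X Y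
    using that s by (auto simp: V_def T_vec shift_in zero_sum_add shift_add vec_add[symmetric])
  show "T s (L1_scale \<mu> c X) = L1_scale \<mu> c (T s X)" if "X \<in> V" for c X
    using that s by (auto simp: V_def T_vec zero_sum_scale shift_scale vec_scale[symmetric])
  show "L1_norm \<mu> (T s X) \<le> (1 + sqrt (M / 2)) * L1_norm \<mu> X" if "X \<in> V" for X
    using that s by (auto simp: V_def T_vec vec_shift_norm_le)
qed (use M_nonneg subspace_V in auto)

definition b :: "'a \<Rightarrow> ('w \<Rightarrow> real) set" where
  "b s = vec (\<lambda>t. of_bool (t = s) - of_bool (t = \<one>))"

lemma b_in_V: "s \<in> carrier G \<Longrightarrow> b s \<in> V"
  unfolding b_def V_def by (intro imageI zero_sum_point_difference) auto

lemma b_norm: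
  assumes "s \<in> carrier G" "s \<noteq> \<one>"
  shows "L1_norm \<mu> (b s) = norm (f s - f \<one>) + 2"
  using assms
  by (simp add: b_def vec_norm zero_sum_point_difference lin_comb_point_difference l1_norm_point_difference)

text \<open>
  Translating \<open>\<delta>\<^sub>t - \<delta>\<^sub>e\<close> by \<open>s\<close> gives \<open>\<delta>\<^sub>s\<^sub>t - \<delta>\<^sub>s\<close>, and adding \<open>\<delta>\<^sub>s - \<delta>\<^sub>e\<close> telescopes.
\<close>

lemma b_mult:
  assumes s: "s \<in> carrier G" and t: "t \<in> carrier G"
  shows "b (s \<otimes> t) = L1_add \<mu> (T s (b t)) (b s)"
proof -
  let ?a = "\<lambda>x. \<lambda>u. of_bool (u = x) - of_bool (u = \<one>) :: real"
  have in_D: "?a x \<in> D" if "x \<in> carrier G" for x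
    using that by (simp add: zero_sum_point_difference)
  have "L1_add \<mu> (T s (b t)) (b s)
      = L1_class \<mu> (\<lambda>y. lin_comb (\<lambda>u. g u y) (shift s (?a t)) + lin_comb (\<lambda>u. g u y) (?a s))"
    using in_D[OF t] by (simp add: b_def T_vec) (simp add: vec_def L1_add_class lin_comb_g_integrable)
  also have "\<dots> = b (s \<otimes> t)"
    using s t by (simp add: lin_comb_shift in_D lin_comb_point_difference b_def vec_def)
  finally show ?thesis ..
qed

end

theorem theorem1p1:
  fixes \<Gamma> :: "('g, 'm) monoid_scheme" (structure)
    and f :: "'g \<Rightarrow> 'h :: {real_inner, complete_space}"
    and M :: real
  assumes "group \<Gamma>" and "countable (carrier \<Gamma>)"
    and "M \<ge> 0"
    and "\<And>s x y. \<lbrakk>s \<in> carrier \<Gamma>; x \<in> carrier \<Gamma>; y \<in> carrier \<Gamma>\<rbrakk> \<Longrightarrow>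
           (norm (f (s \<otimes> x) - f (s \<otimes> y)))\<^sup>2 \<le> (norm (f x - f y))\<^sup>2 + M"
  shows "\<exists>(\<mu> :: (nat \<Rightarrow> real) measure) E \<pi> b.
           L1_closed_subspace \<mu> E \<and>
           L1_representation \<Gamma> \<mu> E \<pi> \<and>
           L1_uniformly_bounded \<Gamma> \<mu> E \<pi> \<and>
           L1_cocycle \<Gamma> \<mu> E \<pi> b \<and>
           (\<forall>s\<in>carrier \<Gamma> - {\<one>}. L1_norm \<mu> (b s) = norm (f s - f \<one>) + 2)"
proof -
  obtain g :: "'g \<Rightarrow> (nat \<Rightarrow> real) \<Rightarrow> real"
    where g: "\<And>t. integrable tagged_gaussian (g t)"
      "\<And>a. finite {t. a t \<noteq> 0} \<Longrightarrow> {t. a t \<noteq> 0} \<subseteq> carrier \<Gamma> \<Longrightarrow>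
        (LINT y|tagged_gaussian. \<bar>lin_comb (\<lambda>t. g t y) a\<bar>) = norm (lin_comb f a) + l1_norm a"
    using L1_realisation[OF assms(2), of f] by blast
  interpret almost_isometric_map \<Gamma> f M g tagged_gaussian
    by (intro almost_isometric_map.intro almost_isometric_map_axioms.intro assms g)
  define E where "E = L1_closure tagged_gaussian V"
  define \<pi> where "\<pi> s = L1_extension tagged_gaussian V (T s)" for s
  have V_E: "V \<subseteq> E"
    unfolding E_def by (intro subset_L1_closure L1_subspaceD(1) subspace_V)
  have rep: "L1_representation \<Gamma> tagged_gaussian E \<pi>" "L1_uniformly_bounded \<Gamma> tagged_gaussian E \<pi>"
    unfolding E_def \<pi>_def
    by (intro L1_representation_extension[OF assms(1) T_bounded];
      force simp: V_def T_vec shift_in shift_one shift_mult)+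
  have "L1_cocycle \<Gamma> tagged_gaussian E \<pi> b"
    unfolding L1_cocycle_def
  proof (intro conjI ballI)
    show "b s \<in> E" if "s \<in> carrier \<Gamma>" for s
      using that b_in_V V_E by blast
    show "b (s \<otimes> t) = L1_add tagged_gaussian (\<pi> s (b t)) (b s)"
      if "s \<in> carrier \<Gamma>" "t \<in> carrier \<Gamma>" for s t
      unfolding \<pi>_def L1_bounded_on_subspace.extension_eq[OF T_bounded[OF that(1)] b_in_V[OF that(2)]]
      using that by (rule b_mult)
  qed
  moreover have "L1_closed_subspace tagged_gaussian E"
    unfolding E_def by (intro L1_closed_subspace_closure subspace_V)
  ultimately show ?thesis
    using rep b_norm by blast
qed

end
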